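(* Let $k\ge 2$. The hyperelliptic Göpel variety, i.e. the (closure of the) image of the rational map $C_{2k,k}:\mathbb{A}^{2k}\dashrightarrow\mathbb{P}([k,k])$, is the GIT quotient $(\mathbb{P}^1)^{2k}/\!/PGL(2)$ with respect to the democratic polarization.
   Context: The base field is $\mathbb{C}$. For a tableau $T$ of shape $(k,k)$ (two rows of length $k$) filled bijectively with the integers $1,\dots,2k$, with first row $a_1,\dots,a_k$ and second row $b_1,\dots,b_k$, let $$P_T(\alpha)=(\alpha_{a_1}-\alpha_{b_1})\cdots(\alpha_{a_k}-\alpha_{b_k}).$$ The span of the polynomials $P_T$ in $\mathbb{C}[\alpha_1,\dots,\alpha_{2k}]_k$ is a copy of the Specht module $[k,k]$ of the symmetric group $S_{2k}$. The rational map $C_{2k,k}$ from the space $\mathbb{A}^{2k}$ of diagonal matrices with entries $\alpha=(\alpha_1,\dots,\alpha_{2k})$ to $\mathbb{P}([k,k])$ is the one defined by the linear system spanned by the polynomials $P_T$. The democratic polarization is the line bundle $\mathcal{O}(1,\dots,1)$ on $(\mathbb{P}^1)^{2k}$, with $PGL(2)$ acting diagonally. *)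

theory Defs
  imports "HOL-Analysis.Analysis" "HOL-Library.Function_Algebras"
begin

section \<open>Polynomials as polynomial functions\<close>

text \<open>Polynomials over \<open>\<complex>\<close> are represented by the functions they define; as \<open>\<complex>\<close> is infinite,
  nothing is lost. Sums and products of functions are the pointwise ones of
  \<^theory>\<open>HOL-Library.Function_Algebras\<close>.\<close>

definition fscale :: "complex \<Rightarrow> ('x \<Rightarrow> complex) \<Rightarrow> 'x \<Rightarrow> complex" where
  "fscale c f = (\<lambda>x. c * f x)"

interpretation cfun: vector_space "fscale :: complex \<Rightarrow> ('x \<Rightarrow> complex) \<Rightarrow> 'x \<Rightarrow> complex"
  by unfold_locales (auto simp: fscale_def algebra_simps)

definition hom_polys :: "'i set \<Rightarrow> nat \<Rightarrow> (('i \<Rightarrow> complex) \<Rightarrow> complex) set" where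
  "hom_polys I d = cfun.span {\<lambda>x. \<Prod>j<d. x (m j) | m. \<forall>j<d. m j \<in> I}"

section \<open>Complex varieties as spaces with functions\<close>

text \<open>A variety is given by its (closed) points, the Zariski topology and, for every open \<open>U\<close>,
  the \<open>\<complex>\<close>-valued functions regular on \<open>U\<close>. Values outside \<open>U\<close> of a member of
  \<open>regular_on V U\<close> are irrelevant.\<close>

record 'p variety =
  zariski :: "'p topology"
  regular_on :: "'p set \<Rightarrow> ('p \<Rightarrow> complex) set"

definition variety_iso :: "'p variety \<Rightarrow> 'q variety \<Rightarrow> ('p \<Rightarrow> 'q) \<Rightarrow> bool" where
  "variety_iso X Y \<phi> \<longleftrightarrow>
     homeomorphic_map (zariski X) (zariski Y) \<phi> \<and>
     (\<forall>U h. openin (zariski Y) U \<longrightarrow>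
        (h \<in> regular_on Y U \<longleftrightarrow> h \<circ> \<phi> \<in> regular_on X {x \<in> topspace (zariski X). \<phi> x \<in> U}))"

definition isomorphic_varieties :: "'p variety \<Rightarrow> 'q variety \<Rightarrow> bool" (infix "\<cong>\<^sub>v" 50) where
  "X \<cong>\<^sub>v Y \<longleftrightarrow> (\<exists>\<phi>. variety_iso X Y \<phi>)"

text \<open>In the following, a point of a projective variety is an orbit \<open>p\<close> of \<open>\<complex>\<^sup>*\<close> on an affine cone,
  and \<open>S d\<close> is a space of functions on that cone which are homogeneous of degree \<open>d\<close>.
  The non-vanishing loci of homogeneous functions form a basis of the Zariski topology, and a
  regular function is locally a quotient of two homogeneous functions of the same degree.\<close>

definition nonvanishing :: "'x set set \<Rightarrow> ('x \<Rightarrow> complex) \<Rightarrow> 'x set set" where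
  "nonvanishing X F = {p \<in> X. \<forall>x\<in>p. F x \<noteq> 0}"

definition proj_topology :: "'x set set \<Rightarrow> (nat \<Rightarrow> ('x \<Rightarrow> complex) set) \<Rightarrow> 'x set topology" where
  "proj_topology X S = topology_generated_by {nonvanishing X F | d F. F \<in> S d}"

definition proj_regular ::
  "'x set set \<Rightarrow> (nat \<Rightarrow> ('x \<Rightarrow> complex) set) \<Rightarrow> 'x set set \<Rightarrow> ('x set \<Rightarrow> complex) set" where
  "proj_regular X S U =
     {h. \<forall>p\<in>U. \<exists>W. openin (proj_topology X S) W \<and> p \<in> W \<and> W \<subseteq> U \<and>
           (\<exists>d. \<exists>F\<in>S d. \<exists>G\<in>S d. \<forall>q\<in>W. \<forall>x\<in>q. G x \<noteq> 0 \<and> h q = F x / G x)}"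

definition proj_variety :: "'x set set \<Rightarrow> (nat \<Rightarrow> ('x \<Rightarrow> complex) set) \<Rightarrow> 'x set variety" where
  "proj_variety X S = \<lparr>zariski = proj_topology X S, regular_on = proj_regular X S\<rparr>"

section \<open>The projective space of a linear system\<close>

text \<open>For a vector space \<open>V\<close> of functions, the linear system \<open>V\<close> defines the rational map
  sending \<open>x\<close> to the point of \<open>\<P>(V)\<close> given by the evaluation functional \<open>f \<mapsto> f x\<close>, i.e. the
  points of \<open>\<P>(V)\<close> are the nonzero linear functionals on \<open>V\<close> up to scalars. Functionals are
  extended by 0 outside \<open>V\<close>. With respect to a basis \<open>f\<^sub>0, \<dots>, f\<^sub>r\<close> of \<open>V\<close> this is the map
  \<open>x \<mapsto> (f\<^sub>0 x : \<dots> : f\<^sub>r x)\<close>.\<close>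

definition dual_space :: "('x \<Rightarrow> complex) set \<Rightarrow> (('x \<Rightarrow> complex) \<Rightarrow> complex) set" where
  "dual_space V = {l. (\<forall>f\<in>V. \<forall>g\<in>V. l (f + g) = l f + l g) \<and>
                      (\<forall>c. \<forall>f\<in>V. l (fscale c f) = c * l f) \<and>
                      (\<forall>f. f \<notin> V \<longrightarrow> l f = 0)}"

definition line_class :: "('v \<Rightarrow> complex) \<Rightarrow> ('v \<Rightarrow> complex) set" where
  "line_class l = {fscale c l | c. c \<noteq> 0}"

definition proj_points :: "('x \<Rightarrow> complex) set \<Rightarrow> (('x \<Rightarrow> complex) \<Rightarrow> complex) set set" where
  "proj_points V = {line_class l | l. l \<in> dual_space V \<and> l \<noteq> 0}"

definition eval_at :: "('x \<Rightarrow> complex) set \<Rightarrow> 'x \<Rightarrow> ('x \<Rightarrow> complex) \<Rightarrow> complex" where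
  "eval_at V x = (\<lambda>f. if f \<in> V then f x else 0)"

definition linear_system_image ::
    "('x \<Rightarrow> complex) set \<Rightarrow> (('x \<Rightarrow> complex) \<Rightarrow> complex) set set" where
  "linear_system_image V = {line_class (eval_at V x) | x. \<exists>f\<in>V. f x \<noteq> 0}"

definition closed_subvariety ::
    "('x \<Rightarrow> complex) set \<Rightarrow> (('x \<Rightarrow> complex) \<Rightarrow> complex) set set
      \<Rightarrow> (('x \<Rightarrow> complex) \<Rightarrow> complex) set variety" where
  "closed_subvariety V Y = proj_variety Y (hom_polys V)"

section \<open>The hyperelliptic Goepel variety\<close>

text \<open>\<open>T (r, j)\<close> is the entry in row \<open>r\<close> and column \<open>j\<close>.\<close>

definition is_tableau :: "nat \<Rightarrow> (nat \<times> nat \<Rightarrow> nat) \<Rightarrow> bool" where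
  "is_tableau k T \<longleftrightarrow> bij_betw T ({1..2} \<times> {1..k}) {1..2*k}"

text \<open>A point of \<open>\<A>\<^sup>2\<^sup>k\<close> is given by a sequence \<open>\<alpha>\<close>, of which only
  \<open>\<alpha> 1, \<dots>, \<alpha> (2 * k)\<close> (the entries of the diagonal matrix) enter.\<close>

definition tableau_poly :: "nat \<Rightarrow> (nat \<times> nat \<Rightarrow> nat) \<Rightarrow> (nat \<Rightarrow> complex) \<Rightarrow> complex" where
  "tableau_poly k T = (\<lambda>\<alpha>. \<Prod>j=1..k. \<alpha> (T (1, j)) - \<alpha> (T (2, j)))"

definition specht :: "nat \<Rightarrow> ((nat \<Rightarrow> complex) \<Rightarrow> complex) set" where
  "specht k = cfun.span {tableau_poly k T | T. is_tableau k T}"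

definition goepel_points :: "nat \<Rightarrow> (((nat \<Rightarrow> complex) \<Rightarrow> complex) \<Rightarrow> complex) set set" where
  "goepel_points k =
     proj_topology (proj_points (specht k)) (hom_polys (specht k))
       closure_of linear_system_image (specht k)"

definition hyperelliptic_goepel_variety ::
    "nat \<Rightarrow> (((nat \<Rightarrow> complex) \<Rightarrow> complex) \<Rightarrow> complex) set variety" where
  "hyperelliptic_goepel_variety k = closed_subvariety (specht k) (goepel_points k)"

section \<open>Proj of a graded algebra\<close>

text \<open>\<open>R d\<close> is the degree \<open>d\<close> part of a graded \<open>\<complex>\<close>-algebra \<open>R\<close> (the external direct sum of the
  \<open>R d\<close>), with \<open>1 \<in> R 0\<close>. For finitely generated \<open>R\<close>, the closed points of \<open>Spec R\<close> are the
  \<open>\<complex>\<close>-algebra homomorphisms \<open>\<xi> : R \<rightarrow> \<complex>\<close>, here split into their restrictions \<open>\<xi> d\<close> to \<open>R d\<close>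
  (extended by 0); the grading is the action of \<open>c \<in> \<complex>\<^sup>*\<close> by \<open>c\<^sup>d\<close> on \<open>\<xi> d\<close>, and \<open>Proj R\<close> is
  the quotient by \<open>\<complex>\<^sup>*\<close> of the complement of the zero set of the irrelevant ideal.\<close>

definition graded_characters ::
    "(nat \<Rightarrow> ('x \<Rightarrow> complex) set) \<Rightarrow> (nat \<Rightarrow> ('x \<Rightarrow> complex) \<Rightarrow> complex) set" where
  "graded_characters R =
     {\<xi>. (\<forall>d. \<xi> d \<in> dual_space (R d)) \<and> \<xi> 0 1 = 1 \<and>
         (\<forall>d e. \<forall>f\<in>R d. \<forall>g\<in>R e. \<xi> (d + e) (f * g) = \<xi> d f * \<xi> e g)}"

definition graded_class ::
    "(nat \<Rightarrow> ('x \<Rightarrow> complex) \<Rightarrow> complex) \<Rightarrow> (nat \<Rightarrow> ('x \<Rightarrow> complex) \<Rightarrow> complex) set" where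
  "graded_class \<xi> = {\<lambda>d f. c ^ d * \<xi> d f | c. c \<noteq> 0}"

definition Proj_points ::
    "(nat \<Rightarrow> ('x \<Rightarrow> complex) set) \<Rightarrow> (nat \<Rightarrow> ('x \<Rightarrow> complex) \<Rightarrow> complex) set set" where
  "Proj_points R = {graded_class \<xi> | \<xi>. \<xi> \<in> graded_characters R \<and> (\<exists>d>0. \<exists>f\<in>R d. \<xi> d f \<noteq> 0)}"

definition Proj ::
    "(nat \<Rightarrow> ('x \<Rightarrow> complex) set) \<Rightarrow> (nat \<Rightarrow> ('x \<Rightarrow> complex) \<Rightarrow> complex) set variety" where
  "Proj R = proj_variety (Proj_points R) (\<lambda>d. {\<lambda>\<xi>. \<xi> d f | f. f \<in> R d})"

section \<open>The GIT quotient of a product of projective lines by PGL(2)\<close>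

text \<open>\<open>H\<^sup>0((\<P>\<^sup>1)\<^sup>n, \<O>(d,\<dots>,d))\<close>: the polynomials in the homogeneous coordinates of
  \<open>p 1, \<dots>, p n\<close> which are homogeneous of degree \<open>d\<close> in the two coordinates of each \<open>p i\<close>.\<close>

definition sections_O :: "nat \<Rightarrow> nat \<Rightarrow> ((nat \<Rightarrow> complex^2) \<Rightarrow> complex) set" where
  "sections_O n d =
     cfun.span {\<lambda>p. \<Prod>i=1..n. (p i $ 1) ^ e i * (p i $ 2) ^ (d - e i) | e. \<forall>i\<in>{1..n}. e i \<le> d}"

text \<open>The action of \<open>GL(2)\<close> on the sections of \<open>\<O>(d,\<dots>,d)\<close> on \<open>(\<P>\<^sup>1)\<^sup>2\<^sup>k\<close> which is induced by the
  diagonal action on \<open>(\<complex>\<^sup>2)\<^sup>2\<^sup>k\<close>, twisted by a power of the determinant so that scalar matrices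
  act trivially. It is thus an action of \<open>PGL(2)\<close>. As \<open>PGL(2)\<close> has no nontrivial characters,
  this is the only \<open>PGL(2)\<close>-linearization of the democratic polarization.\<close>

definition pgl_action ::
    "nat \<Rightarrow> nat \<Rightarrow> complex^2^2 \<Rightarrow> ((nat \<Rightarrow> complex^2) \<Rightarrow> complex) \<Rightarrow> (nat \<Rightarrow> complex^2) \<Rightarrow> complex" where
  "pgl_action k d A s = (\<lambda>p. det A ^ (k * d) * s (\<lambda>i. matrix_inv A *v p i))"

lemma pgl_action_scalar:
  assumes "s \<in> sections_O (2 * k) d" "c \<noteq> 0"
  shows "pgl_action k d (mat c) s = s"
proof -
  have "mat (inverse c) ** mat c = (mat 1 :: complex^2^2)"
       "mat c ** mat (inverse c) = (mat 1 :: complex^2^2)"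
    using assms(2) by (auto simp: vec_eq_iff matrix_matrix_mult_def mat_def sum_2 forall_2)
  then have inv: "matrix_inv (mat c) = (mat (inverse c) :: complex^2^2)"
    unfolding matrix_inv_def
    by (intro some_equality) (auto, metis matrix_mul_assoc matrix_mul_lid matrix_mul_rid)
  have coord: "(mat (inverse c) *v v) $ j = inverse c * v $ j" for v :: "complex^2" and j
    using exhaust_2[of j] by (auto simp: matrix_vector_mult_def mat_def sum_2)
  have det: "det (mat c :: complex^2^2) = c ^ 2"
    by (simp add: det_2 mat_def power2_eq_square)
  from assms(1) have "s (\<lambda>i. mat (inverse c) *v p i) = inverse c ^ (2 * k * d) * s p" for p
    unfolding sections_O_def
  proof (induction rule: cfun.span_induct_alt)
    case base
    show ?case by simp
  next
    case (step a m t)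
    then obtain e where m: "m = (\<lambda>p. \<Prod>i=1..2*k. (p i $ 1) ^ e i * (p i $ 2) ^ (d - e i))"
      and e: "\<forall>i\<in>{1..2*k}. e i \<le> d" by auto
    have "m (\<lambda>i. mat (inverse c) *v p i) =
        (\<Prod>i=1..2*k. inverse c ^ d * ((p i $ 1) ^ e i * (p i $ 2) ^ (d - e i)))"
      unfolding m coord
    proof (rule prod.cong[OF refl])
      fix i assume "i \<in> {1..2*k}"
      then have "inverse c ^ d = inverse c ^ e i * inverse c ^ (d - e i)"
        using e by (simp flip: power_add)
      then show "(inverse c * p i $ 1) ^ e i * (inverse c * p i $ 2) ^ (d - e i) =
          inverse c ^ d * ((p i $ 1) ^ e i * (p i $ 2) ^ (d - e i))"
        by (simp only: power_mult_distrib mult_ac)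
    qed
    also have "\<dots> = inverse c ^ (2 * k * d) * m p"
      unfolding m prod.distrib by (simp add: mult_ac flip: power_mult)
    finally show ?case using step.IH by (simp add: fscale_def algebra_simps)
  qed
  then show ?thesis
    using assms(2) by (auto simp: pgl_action_def inv det fun_eq_iff power_inverse mult_ac
        simp flip: power_mult)
qed

definition invariant_sections :: "nat \<Rightarrow> nat \<Rightarrow> ((nat \<Rightarrow> complex^2) \<Rightarrow> complex) set" where
  "invariant_sections k d =
     {s \<in> sections_O (2 * k) d. \<forall>A. invertible A \<longrightarrow> pgl_action k d A s = s}"

text \<open>The GIT quotient \<open>(\<P>\<^sup>1)\<^sup>2\<^sup>k // PGL(2)\<close> with respect to \<open>L = \<O>(1,\<dots>,1)\<close> is
  \<open>Proj\<close> of \<open>\<Oplus>\<^sub>d H\<^sup>0((\<P>\<^sup>1)\<^sup>2\<^sup>k, L\<^sup>d)\<close> restricted to \<open>PGL(2)\<close>-invariant sections.\<close>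

definition democratic_GIT_quotient ::
    "nat \<Rightarrow> (nat \<Rightarrow> ((nat \<Rightarrow> complex^2) \<Rightarrow> complex) \<Rightarrow> complex) set variety" where
  "democratic_GIT_quotient k = Proj (invariant_sections k)"

end

theory Submission
  imports Defs
begin

text \<open>Write \<open>V\<close> for the span of the tableau polynomials and \<open>R = \<Oplus>\<^sub>d R\<^sub>d\<close> for the ring of
  \<open>PGL(2)\<close>-invariant sections of the powers of \<open>\<O>(1,\<dots>,1)\<close> on \<open>(\<P>\<^sup>1)\<^sup>2\<^sup>k\<close>. Substituting the affine
  representatives \<open>(\<alpha>\<^sub>i, 1)\<close> for the points of \<open>\<P>\<^sup>1\<close> turns the bracket \<open>[i j]\<close>, the determinant of
  the \<open>i\<close>-th and the \<open>j\<close>-th vector, into \<open>\<alpha>\<^sub>i - \<alpha>\<^sub>j\<close>, hence the product of the brackets of the columns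
  of a tableau into its tableau polynomial. Multihomogeneous polynomials are determined by
  their values at affine representatives (\<open>multihom_zero_on_affine\<close>), so \<open>R\<close> is a graded ring of
  functions on the affine space of the \<open>\<alpha>\<close>.

  The theorem holds because \<open>R\<close> is generated by \<open>R\<^sub>1\<close> and \<open>R\<^sub>1\<close> is identified with \<open>V\<close>
  (\<open>invariants_generated_in_degree_one\<close>). Granting this, a graded character of \<open>R\<close> is the same
  as a linear functional on \<open>V\<close> that satisfies every homogeneous relation between the elements
  of \<open>V\<close>. Such functionals, up to scalars, are the points of the Zariski closure of the image of
  the linear system, and homogeneous polynomials on \<open>V\<^sup>*\<close> restrict to that closure exactly as
  elements of \<open>R\<close> evaluate at characters. This is the general statement
  \<open>closure_of_image_iso_Proj\<close>.

  Generation in degree one has two parts.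

  The first fundamental theorem for \<open>SL(2)\<close> (\<open>semi_invariant_in_bracket_span\<close>): invariants are
  combinations of products of brackets. Restrict an invariant \<open>f\<close> of \<open>n + 2\<close> vectors to the
  locus where the last two agree. By induction on the number of vectors the restriction is a
  combination of products of brackets. Relabelling some occurrences of the merged vector lifts
  this combination back to \<open>n + 2\<close> vectors. The difference between \<open>f\<close> and the lift vanishes on
  the locus, so it is a multiple of the last bracket, and the cofactor is an invariant of lower
  degree.

  Kempe's theorem (\<open>regular_bracket_monomial_in_tableau_products\<close>): view a product of brackets of
  degree \<open>d\<close> in every vector as a \<open>d\<close>-regular multigraph on \<open>2k\<close> vertices and divide the vertices
  into a lower and an upper half. There are as many edges inside the lower half as inside
  the upper half, and a Pluecker relation replaces one edge of each kind by two edges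
  across. What remains are bipartite regular graphs. These decompose
  into \<open>d\<close> perfect matchings by Hall's theorem, and a perfect matching is a tableau.\<close>

section \<open>Spans of functions\<close>

lemma span_mult_closed:
  assumes "f \<in> cfun.span A" "g \<in> cfun.span B"
    and "\<And>a b. a \<in> A \<Longrightarrow> b \<in> B \<Longrightarrow> a * b \<in> cfun.span C"
  shows "f * g \<in> cfun.span C"
proof -
  have 1: "a * g \<in> cfun.span C" if "a \<in> A" for a
    using assms(2)
  proof (induction rule: cfun.span_induct_alt)
    case base
    show ?case by (simp only: mult_zero_right cfun.span_zero)
  next
    case (step c x y)
    have eq: "a * (fscale c x + y) = fscale c (a * x) + a * y"
      by (auto simp: fscale_def fun_eq_iff algebra_simps)
    show ?case
      unfolding eq by (intro cfun.span_add cfun.span_scale step assms(3)[OF that])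
  qed
  from assms(1) show ?thesis
  proof (induction rule: cfun.span_induct_alt)
    case base
    show ?case by (simp only: mult_zero_left cfun.span_zero)
  next
    case (step c x y)
    have eq: "(fscale c x + y) * g = fscale c (x * g) + y * g"
      by (auto simp: fscale_def fun_eq_iff algebra_simps)
    show ?case
      unfolding eq by (intro cfun.span_add cfun.span_scale step 1)
  qed
qed

lemma span_precompose:
  assumes "f \<in> cfun.span A" and "\<And>a. a \<in> A \<Longrightarrow> (\<lambda>x. a (\<sigma> x)) \<in> cfun.span C"
  shows "(\<lambda>x. f (\<sigma> x)) \<in> cfun.span C"
  using assms(1)
proof (induction rule: cfun.span_induct_alt)
  case base
  have "(\<lambda>x. (0 :: 'a \<Rightarrow> complex) (\<sigma> x)) = 0"
    by (auto simp: fun_eq_iff)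
  then show ?case by (simp only: cfun.span_zero)
next
  case (step c x y)
  have "(\<lambda>z. (fscale c x + y) (\<sigma> z)) = fscale c (\<lambda>z. x (\<sigma> z)) + (\<lambda>z. y (\<sigma> z))"
    by (auto simp: fscale_def fun_eq_iff)
  then show ?case
    using step assms(2) by (simp add: cfun.span_add cfun.span_scale)
qed

section \<open>Isomorphisms of projective varieties\<close>

lemma nonvanishing_inter:
  "nonvanishing X F \<inter> nonvanishing X G = nonvanishing X (F * G)"
  by (auto simp: nonvanishing_def)

text \<open>Non-vanishing loci are closed under intersection because products of homogeneous
  functions are homogeneous; so they form a basis and not only a subbasis.\<close>

lemma proj_topology_basis:
  assumes mult: "\<And>d e F G. F \<in> S d \<Longrightarrow> G \<in> S e \<Longrightarrow> F * G \<in> S (d + e)"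
    and "openin (proj_topology X S) U" "p \<in> U"
  shows "\<exists>d. \<exists>F\<in>S d. p \<in> nonvanishing X F \<and> nonvanishing X F \<subseteq> U"
proof -
  have "generate_topology_on {nonvanishing X F | d F. F \<in> S d} U"
    using assms(2) by (simp add: proj_topology_def openin_topology_generated_by)
  then have "\<forall>p\<in>U. \<exists>d. \<exists>F\<in>S d. p \<in> nonvanishing X F \<and> nonvanishing X F \<subseteq> U"
  proof (induction rule: generate_topology_on.induct)
    case (Int a b)
    show ?case
    proof
      fix p assume p: "p \<in> a \<inter> b"
      obtain d F where F: "F \<in> S d" "p \<in> nonvanishing X F" "nonvanishing X F \<subseteq> a"
        using Int.IH(1) p by (meson IntD1)
      obtain e G where G: "G \<in> S e" "p \<in> nonvanishing X G" "nonvanishing X G \<subseteq> b"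
        using Int.IH(2) p by (meson IntD2)
      have "p \<in> nonvanishing X (F * G)" "nonvanishing X (F * G) \<subseteq> a \<inter> b"
        using F(2,3) G(2,3) unfolding nonvanishing_inter[symmetric] by auto
      then show "\<exists>d. \<exists>F\<in>S d. p \<in> nonvanishing X F \<and> nonvanishing X F \<subseteq> a \<inter> b"
        using mult[OF F(1) G(1)] by (intro exI bexI[of _ "F * G"] conjI)
    qed
  next
    case (UN K)
    then show ?case by (metis (no_types, lifting) Union_iff Union_upper subset_trans)
  qed auto
  with assms(3) show ?thesis by blast
qed

lemma proj_regularI:
  assumes "\<And>p. p \<in> U \<Longrightarrow> \<exists>W d F G. openin (proj_topology X S) W \<and> p \<in> W \<and> W \<subseteq> U \<and>
      F \<in> S d \<and> G \<in> S d \<and> (\<forall>q\<in>W. \<forall>x\<in>q. G x \<noteq> 0 \<and> h q = F x / G x)"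
  shows "h \<in> proj_regular X S U"
  unfolding proj_regular_def
proof (intro CollectI ballI)
  fix p assume "p \<in> U"
  from assms[OF this] obtain W d F G where *: "openin (proj_topology X S) W" "p \<in> W" "W \<subseteq> U"
    "F \<in> S d" "G \<in> S d" "\<forall>q\<in>W. \<forall>x\<in>q. G x \<noteq> 0 \<and> h q = F x / G x"
    by (elim exE conjE)
  show "\<exists>W. openin (proj_topology X S) W \<and> p \<in> W \<and> W \<subseteq> U \<and>
      (\<exists>d. \<exists>F\<in>S d. \<exists>G\<in>S d. \<forall>q\<in>W. \<forall>x\<in>q. G x \<noteq> 0 \<and> h q = F x / G x)"
    by (rule exI[of _ W], intro conjI * exI[of _ d], rule bexI[OF _ *(4)], rule bexI[OF _ *(5)],
        rule *(6))
qed

text \<open>A map between the cones that transports the homogeneous functions in both directions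
  matches the basic open sets and the local quotients \<open>F / G\<close>, which is all that the structure
  of a projective variety consists of. No map of graded rings needs to be mentioned.\<close>

lemma variety_iso_of_cone_map:
  fixes \<Xi> :: "'x \<Rightarrow> 'y"
  assumes bij: "bij_betw (image \<Xi>) X Y"
    and push: "\<And>d F. F \<in> S d \<Longrightarrow> \<exists>G\<in>S' d. \<forall>p\<in>X. \<forall>x\<in>p. G (\<Xi> x) = F x"
    and pull: "\<And>d G. G \<in> S' d \<Longrightarrow> \<exists>F\<in>S d. \<forall>p\<in>X. \<forall>x\<in>p. G (\<Xi> x) = F x"
  shows "variety_iso (proj_variety X S) (proj_variety Y S') (image \<Xi>)"
proof -
  define \<phi> where "\<phi> = image \<Xi>"
  define T where "T = proj_topology X S"
  define T' where "T' = proj_topology Y S'"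
  have bij': "bij_betw \<phi> X Y" using bij by (simp add: \<phi>_def)
  define \<psi> where "\<psi> = inv_into X \<phi>"
  have \<psi>\<phi>: "\<psi> (\<phi> p) = p" if "p \<in> X" for p
    using bij' that unfolding \<psi>_def by (simp add: bij_betw_inv_into_left)
  have \<phi>\<psi>: "\<phi> (\<psi> q) = q" "\<psi> q \<in> X" if "q \<in> Y" for q
    using bij' that unfolding \<psi>_def
    by (auto simp: bij_betw_inv_into_right bij_betw_def inv_into_into)
  have \<phi>Y: "\<phi> p \<in> Y" if "p \<in> X" for p
    using bij' that by (auto simp: bij_betw_def)
  have top: "topspace T = \<Union>{nonvanishing X F | d F. F \<in> S d}"
    "topspace T' = \<Union>{nonvanishing Y F | d F. F \<in> S' d}"
    by (simp_all only: T_def T'_def proj_topology_def topology_generated_by_topspace)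
  have topX: "topspace T \<subseteq> X" "topspace T' \<subseteq> Y"
    unfolding top by (auto simp: nonvanishing_def)
  have nv: "\<phi> p \<in> nonvanishing Y G \<longleftrightarrow> p \<in> nonvanishing X F"
    if "\<forall>p\<in>X. \<forall>x\<in>p. G (\<Xi> x) = F x" "p \<in> X" for F G p
    using that \<phi>Y[OF that(2)] by (auto simp: nonvanishing_def \<phi>_def)
  have basic: "openin T (nonvanishing X F)" if "F \<in> S d" for F d
    unfolding T_def proj_topology_def openin_topology_generated_by_iff
    using that by (intro generate_topology_on.Basis) blast
  have basic': "openin T' (nonvanishing Y F)" if "F \<in> S' d" for F d
    unfolding T'_def proj_topology_def openin_topology_generated_by_iff
    using that by (intro generate_topology_on.Basis) blast
  have top_iff: "\<phi> p \<in> topspace T' \<longleftrightarrow> p \<in> topspace T" if "p \<in> X" for p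
  proof
    assume "\<phi> p \<in> topspace T'"
    then obtain d G where G: "G \<in> S' d" "\<phi> p \<in> nonvanishing Y G" unfolding top by blast
    obtain F where "F \<in> S d" "\<forall>p\<in>X. \<forall>x\<in>p. G (\<Xi> x) = F x" using pull[OF G(1)] by blast
    then show "p \<in> topspace T" using nv[OF _ that] G(2) unfolding top by blast
  next
    assume "p \<in> topspace T"
    then obtain d F where F: "F \<in> S d" "p \<in> nonvanishing X F" unfolding top by blast
    obtain G where "G \<in> S' d" "\<forall>p\<in>X. \<forall>x\<in>p. G (\<Xi> x) = F x" using push[OF F(1)] by blast
    then show "\<phi> p \<in> topspace T'" using nv[OF _ that] F(2) unfolding top by blast
  qed
  have cont: "continuous_map T T' \<phi>"
    unfolding T'_def proj_topology_def continuous_on_generated_topo_iff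
  proof (intro conjI allI impI)
    fix U assume "U \<in> {nonvanishing Y F |d F. F \<in> S' d}"
    then obtain d G where G: "G \<in> S' d" "U = nonvanishing Y G" by blast
    obtain F where F: "F \<in> S d" "\<forall>p\<in>X. \<forall>x\<in>p. G (\<Xi> x) = F x" using pull[OF G(1)] by blast
    have "\<phi> -` U \<inter> topspace T = nonvanishing X F"
      using nv[OF F(2)] topX openin_subset[OF basic[OF F(1)]] G(2) by auto
    then show "openin T (\<phi> -` U \<inter> topspace T)" using basic[OF F(1)] by simp
  next
    show "\<phi> ` topspace T \<subseteq> \<Union> {nonvanishing Y F |d F. F \<in> S' d}"
      using top_iff topX(1) unfolding top(2)[symmetric] by blast
  qed
  have cont': "continuous_map T' T \<psi>"
    unfolding T_def proj_topology_def continuous_on_generated_topo_iff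
  proof (intro conjI allI impI)
    fix U assume "U \<in> {nonvanishing X F |d F. F \<in> S d}"
    then obtain d F where F: "F \<in> S d" "U = nonvanishing X F" by blast
    obtain G where G: "G \<in> S' d" "\<forall>p\<in>X. \<forall>x\<in>p. G (\<Xi> x) = F x" using push[OF F(1)] by blast
    have "\<psi> q \<in> U \<longleftrightarrow> q \<in> nonvanishing Y G" if "q \<in> Y" for q
      using nv[OF G(2) \<phi>\<psi>(2)[OF that]] \<phi>\<psi>[OF that] F(2) by simp
    then have "\<psi> -` U \<inter> topspace T' = nonvanishing Y G"
      using topX(2) openin_subset[OF basic'[OF G(1)]] by (intro set_eqI) blast
    then show "openin T' (\<psi> -` U \<inter> topspace T')" using basic'[OF G(1)] by simp
  next
    show "\<psi> ` topspace T' \<subseteq> \<Union> {nonvanishing X F |d F. F \<in> S d}"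
      unfolding top(1)[symmetric]
    proof (rule image_subsetI)
      fix q assume q: "q \<in> topspace T'"
      then have "q \<in> Y" using topX(2) by blast
      then show "\<psi> q \<in> topspace T" using top_iff[OF \<phi>\<psi>(2)] \<phi>\<psi>(1) q by simp
    qed
  qed
  have homeo: "homeomorphic_map T T' \<phi>"
    unfolding homeomorphic_map_maps homeomorphic_maps_def
    using cont cont' \<psi>\<phi> \<phi>\<psi> topX by blast
  have "h \<in> proj_regular Y S' U \<longleftrightarrow> h \<circ> \<phi> \<in> proj_regular X S {p \<in> topspace T. \<phi> p \<in> U}"
    if U: "openin T' U" for U h
  proof
    assume h: "h \<in> proj_regular Y S' U"
    show "h \<circ> \<phi> \<in> proj_regular X S {p \<in> topspace T. \<phi> p \<in> U}"
    proof (rule proj_regularI)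
      fix p assume p: "p \<in> {p \<in> topspace T. \<phi> p \<in> U}"
      then obtain W d G1 G2 where W: "openin T' W" "\<phi> p \<in> W" "W \<subseteq> U" and G: "G1 \<in> S' d" "G2 \<in> S' d"
        and eq: "\<forall>q\<in>W. \<forall>x\<in>q. G2 x \<noteq> 0 \<and> h q = G1 x / G2 x"
        using h unfolding proj_regular_def T'_def by blast
      obtain F1 where F1: "F1 \<in> S d" "\<forall>p\<in>X. \<forall>x\<in>p. G1 (\<Xi> x) = F1 x" using pull[OF G(1)] by blast
      obtain F2 where F2: "F2 \<in> S d" "\<forall>p\<in>X. \<forall>x\<in>p. G2 (\<Xi> x) = F2 x" using pull[OF G(2)] by blast
      define W0 where "W0 = {p \<in> topspace T. \<phi> p \<in> W}"
      have "openin T W0" unfolding W0_def by (rule openin_continuous_map_preimage[OF cont W(1)])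
      moreover have "\<forall>q\<in>W0. \<forall>x\<in>q. F2 x \<noteq> 0 \<and> (h \<circ> \<phi>) q = F1 x / F2 x"
      proof (intro ballI)
        fix q x assume q: "q \<in> W0" "x \<in> q"
        then have "q \<in> X" "\<Xi> x \<in> \<phi> q" "\<phi> q \<in> W" using topX by (auto simp: W0_def \<phi>_def)
        then show "F2 x \<noteq> 0 \<and> (h \<circ> \<phi>) q = F1 x / F2 x"
          using eq F1(2) F2(2) q(2) by (metis comp_apply)
      qed
      moreover have "p \<in> W0" "W0 \<subseteq> {p \<in> topspace T. \<phi> p \<in> U}"
        using W p by (auto simp: W0_def)
      ultimately show "\<exists>W d F G. openin (proj_topology X S) W \<and> p \<in> W \<and>
          W \<subseteq> {p \<in> topspace T. \<phi> p \<in> U} \<and> F \<in> S d \<and> G \<in> S d \<and>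
          (\<forall>q\<in>W. \<forall>x\<in>q. G x \<noteq> 0 \<and> (h \<circ> \<phi>) q = F x / G x)"
        using F1(1) F2(1) unfolding T_def[symmetric]
        by (intro exI[of _ W0] exI[of _ d] exI[of _ F1] exI[of _ F2] conjI)
    qed
  next
    assume h: "h \<circ> \<phi> \<in> proj_regular X S {p \<in> topspace T. \<phi> p \<in> U}"
    show "h \<in> proj_regular Y S' U"
    proof (rule proj_regularI)
      fix p' assume p': "p' \<in> U"
      define p where "p = \<psi> p'"
      have "p' \<in> topspace T'" using U p' openin_subset by blast
      then have "p' \<in> Y" using topX(2) by blast
      then have p: "p \<in> topspace T" "\<phi> p = p'"
        using top_iff[OF \<phi>\<psi>(2)] \<phi>\<psi>(1) \<open>p' \<in> topspace T'\<close> by (simp_all add: p_def)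
      obtain W d F1 F2 where W: "openin T W" "p \<in> W" "W \<subseteq> {p \<in> topspace T. \<phi> p \<in> U}"
        and F: "F1 \<in> S d" "F2 \<in> S d"
        and eq: "\<forall>q\<in>W. \<forall>x\<in>q. F2 x \<noteq> 0 \<and> (h \<circ> \<phi>) q = F1 x / F2 x"
        using h p p' unfolding proj_regular_def T_def[symmetric] by blast
      obtain G1 where G1: "G1 \<in> S' d" "\<forall>p\<in>X. \<forall>x\<in>p. G1 (\<Xi> x) = F1 x" using push[OF F(1)] by blast
      obtain G2 where G2: "G2 \<in> S' d" "\<forall>p\<in>X. \<forall>x\<in>p. G2 (\<Xi> x) = F2 x" using push[OF F(2)] by blast
      have "openin T' (\<phi> ` W)"
        using homeomorphic_map_openness_eq[OF homeo] W(1) by blast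
      moreover have "\<forall>q\<in>\<phi> ` W. \<forall>x\<in>q. G2 x \<noteq> 0 \<and> h q = G1 x / G2 x"
      proof (intro ballI)
        fix q' y assume q: "q' \<in> \<phi> ` W" "y \<in> q'"
        then obtain q x where qx: "q \<in> W" "x \<in> q" "q' = \<phi> q" "y = \<Xi> x" by (auto simp: \<phi>_def)
        then have "q \<in> X" using W(3) topX by auto
        then show "G2 y \<noteq> 0 \<and> h q' = G1 y / G2 y"
          using eq G1(2) G2(2) qx by (metis comp_apply)
      qed
      moreover have "p' \<in> \<phi> ` W" "\<phi> ` W \<subseteq> U"
        using W p by auto
      ultimately show "\<exists>W d F G. openin (proj_topology Y S') W \<and> p' \<in> W \<and> W \<subseteq> U \<and>
          F \<in> S' d \<and> G \<in> S' d \<and> (\<forall>q\<in>W. \<forall>x\<in>q. G x \<noteq> 0 \<and> h q = F x / G x)"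
        using G1(1) G2(1) unfolding T'_def[symmetric]
        by (intro exI[of _ "\<phi> ` W"] exI[of _ d] exI[of _ G1] exI[of _ G2] conjI)
    qed
  qed
  with homeo show ?thesis
    by (simp add: variety_iso_def proj_variety_def T_def T'_def \<phi>_def)
qed

section \<open>Homogeneous polynomials on a dual space\<close>

lemma hom_polys_generator:
  "(\<And>j. j < d \<Longrightarrow> m j \<in> I) \<Longrightarrow> (\<lambda>x. \<Prod>j<d. x (m j)) \<in> hom_polys I d"
  unfolding hom_polys_def by (intro cfun.span_base CollectI exI[of _ m]) simp

lemma hom_polys_one: "1 \<in> hom_polys I 0"
  using hom_polys_generator[of 0 undefined I] by (simp add: one_fun_def)

lemma hom_polys_mult:
  assumes "F \<in> hom_polys I d" "G \<in> hom_polys I e"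
  shows "F * G \<in> hom_polys I (d + e)"
  using assms unfolding hom_polys_def
proof (rule span_mult_closed)
  fix a b :: "('a \<Rightarrow> complex) \<Rightarrow> complex"
  assume "a \<in> {\<lambda>x. \<Prod>j<d. x (m j) | m. \<forall>j<d. m j \<in> I}" "b \<in> {\<lambda>x. \<Prod>j<e. x (m j) | m. \<forall>j<e. m j \<in> I}"
  then obtain m m' where m: "a = (\<lambda>x. \<Prod>j<d. x (m j))" "\<forall>j<d. m j \<in> I"
    and m': "b = (\<lambda>x. \<Prod>j<e. x (m' j))" "\<forall>j<e. m' j \<in> I" by auto
  define m'' where "m'' j = (if j < d then m j else m' (j - d))" for j
  have eq: "(\<Prod>j<d + e. x (m'' j)) = (\<Prod>j<d. x (m j)) * (\<Prod>j<e. x (m' j))" for x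
  proof -
    have "(\<Prod>j<d + e. x (m'' j)) = (\<Prod>j<d. x (m'' j)) * (\<Prod>j<e. x (m'' (d + j)))"
      by (induction e) (simp_all add: mult.assoc)
    then show ?thesis by (simp add: m''_def)
  qed
  have "a * b = (\<lambda>x. \<Prod>j<d + e. x (m'' j))"
    by (rule ext) (simp only: times_fun_apply m(1) m'(1) eq)
  moreover have "\<forall>j<d + e. m'' j \<in> I" using m(2) m'(2) by (auto simp: m''_def)
  ultimately show "a * b \<in> cfun.span {\<lambda>x. \<Prod>j<d + e. x (m j) | m. \<forall>j<d + e. m j \<in> I}"
    by (intro cfun.span_base CollectI exI[of _ m''] conjI)
qed

lemma hom_polys_homogeneous:
  assumes "F \<in> hom_polys I d"
  shows "F (fscale c x) = c ^ d * F x"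
  using assms unfolding hom_polys_def
proof (induction rule: cfun.span_induct_alt)
  case (step a m t)
  then obtain mm where "m = (\<lambda>x. \<Prod>j<d. x (mm j))" by blast
  then have "m (fscale c x) = c ^ d * m x"
    by (simp add: fscale_def prod.distrib)
  with step.IH show ?case by (simp add: fscale_def algebra_simps)
qed auto

lemma dual_space_zero_outside: "l \<in> dual_space V \<Longrightarrow> f \<notin> V \<Longrightarrow> l f = 0"
  by (auto simp: dual_space_def)

lemma dual_space_fscale: "l \<in> dual_space V \<Longrightarrow> f \<in> V \<Longrightarrow> l (fscale c f) = c * l f"
  unfolding dual_space_def by blast

lemma fscale_one: "fscale 1 l = l"
  by (simp add: fscale_def)

lemma fscale_zero: "fscale c 0 = 0"
  by (rule ext) (simp add: fscale_def)

lemma dual_space_scale: "l \<in> dual_space V \<Longrightarrow> fscale c l \<in> dual_space V"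
  by (auto simp: dual_space_def) (auto simp: fscale_def algebra_simps)

lemma dual_space_zero: "l \<in> dual_space V \<Longrightarrow> cfun.subspace V \<Longrightarrow> l 0 = 0"
  using dual_space_fscale[of l V 0 0] cfun.subspace_0[of V] by (simp add: fscale_zero)

lemma eval_at_dual: "cfun.subspace V \<Longrightarrow> eval_at V x \<in> dual_space V"
  unfolding dual_space_def eval_at_def
  by (auto simp: cfun.subspace_add cfun.subspace_scale) (auto simp: fscale_def)

lemma line_class_self: "l \<in> line_class l"
  unfolding line_class_def by (intro CollectI exI[of _ 1]) (simp add: fscale_one)

lemma line_class_eqI: "l' \<in> line_class l \<Longrightarrow> line_class l' = line_class l"
proof -
  assume "l' \<in> line_class l"
  then obtain c where c: "c \<noteq> 0" "l' = fscale c l" by (auto simp: line_class_def)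
  have 1: "fscale a l' = fscale (a * c) l" and 2: "fscale a l = fscale (a / c) l'" for a
    using c by (auto simp: fscale_def)
  show ?thesis
  proof (intro equalityI subsetI)
    fix m assume "m \<in> line_class l'"
    then obtain a where "m = fscale a l'" "a \<noteq> 0" by (auto simp: line_class_def)
    then have "m = fscale (a * c) l" "a * c \<noteq> 0" using 1 c(1) by auto
    then show "m \<in> line_class l" unfolding line_class_def by blast
  next
    fix m assume "m \<in> line_class l"
    then obtain a where "m = fscale a l" "a \<noteq> 0" by (auto simp: line_class_def)
    then have "m = fscale (a / c) l'" "a / c \<noteq> 0" using 2 c(1) by auto
    then show "m \<in> line_class l'" unfolding line_class_def by blast
  qed
qed

lemma nonvanishing_line_class:
  assumes "F \<in> hom_polys V d"
  shows "line_class l \<in> nonvanishing X F \<longleftrightarrow> line_class l \<in> X \<and> F l \<noteq> 0"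
  using line_class_self[of l] hom_polys_homogeneous[OF assms, of _ l]
  by (auto simp: nonvanishing_def line_class_def)

lemma hom_polys_zero_pos:
  assumes "F \<in> hom_polys V d" "d > 0"
  shows "F 0 = 0"
proof -
  show ?thesis
    using hom_polys_homogeneous[OF assms(1), of 0 0] assms(2) by (simp add: fscale_zero power_0_left)
qed

lemma hom_polys_0_const: "F \<in> hom_polys V 0 \<Longrightarrow> F x = F y"
  using hom_polys_homogeneous[of F V 0 0 x] hom_polys_homogeneous[of F V 0 0 y]
  by (simp add: fscale_def)

section \<open>The closure of the image of a linear system\<close>

text \<open>The affine cone, without its vertex, over the closure of the image: the common zeros of the
  homogeneous relations between the elements of \<open>V\<close>.\<close>

definition satisfies_relations :: "('x \<Rightarrow> complex) set \<Rightarrow> (('x \<Rightarrow> complex) \<Rightarrow> complex) \<Rightarrow> bool" where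
  "satisfies_relations V l \<longleftrightarrow> l \<in> dual_space V \<and> l \<noteq> 0 \<and>
     (\<forall>d. \<forall>F\<in>hom_polys V d. (\<forall>x. F (eval_at V x) = 0) \<longrightarrow> F l = 0)"

text \<open>As the non-vanishing loci form a basis, a point lies in the closure iff every homogeneous
  polynomial that vanishes on the image vanishes at the point. The image consists only of the
  evaluations that are nonzero on \<open>V\<close>; demanding the vanishing at all evaluations
  is no stronger, since polynomials of positive degree vanish at \<open>0\<close> and those of degree \<open>0\<close>
  are constant.\<close>

lemma closure_of_linear_system_image:
  fixes V :: "('x \<Rightarrow> complex) set"
  assumes V: "cfun.subspace V"
  shows "proj_topology (proj_points V) (hom_polys V) closure_of linear_system_image V =
      {line_class l | l. satisfies_relations V l}" (is "?T closure_of ?A = ?G")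
proof -
  let ?X = "proj_points V"
  have image_nz: "F (eval_at V x) = 0"
    if "F \<in> hom_polys V d" "\<And>x. eval_at V x \<noteq> 0 \<Longrightarrow> F (eval_at V x) = 0"
      "eval_at V y \<noteq> 0" for F d x y
  proof (cases "eval_at V x = 0 \<and> d > 0")
    case False
    show ?thesis
    proof (cases "eval_at V x = 0")
      case True
      then have "F \<in> hom_polys V 0" using False that(1) by simp
      then show ?thesis using hom_polys_0_const[of F V "eval_at V x"] that(2,3) by metis
    qed (use that(2) in blast)
  qed (use that(1) hom_polys_zero_pos in auto)
  have nz_iff: "(\<exists>f\<in>V. f x \<noteq> 0) \<longleftrightarrow> eval_at V x \<noteq> 0" for x
    by (auto simp: eval_at_def fun_eq_iff)
  have A: "?A = {line_class (eval_at V x) | x. eval_at V x \<noteq> 0}"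
    by (simp only: linear_system_image_def nz_iff)
  have AX: "?A \<subseteq> ?X" unfolding A proj_points_def using eval_at_dual[OF V] by blast
  have basic: "openin ?T (nonvanishing ?X F)" if "F \<in> hom_polys V d" for F d
    unfolding proj_topology_def openin_topology_generated_by_iff
    using that by (intro generate_topology_on.Basis) blast
  have "nonvanishing ?X 1 = ?X" by (auto simp: nonvanishing_def)
  then have top: "topspace ?T = ?X"
    using openin_subset[OF basic[OF hom_polys_one]]
    by (auto simp: proj_topology_def topology_generated_by_topspace nonvanishing_def)
  have key: "line_class l \<in> ?T closure_of ?A \<longleftrightarrow> satisfies_relations V l"
    if l: "l \<in> dual_space V" "l \<noteq> 0" for l
  proof -
    have lX: "line_class l \<in> ?X" using l by (auto simp: proj_points_def)
    have "\<exists>f\<in>V. l f \<noteq> 0" using l dual_space_zero_outside[OF l(1)] by (auto simp: fun_eq_iff)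
    then obtain f where f: "f \<in> V" "l f \<noteq> 0" by blast
    then have "f \<noteq> 0" using dual_space_zero[OF l(1) V] by auto
    then obtain y where "f y \<noteq> 0" by (auto simp: fun_eq_iff)
    then have y: "eval_at V y \<noteq> 0" using f(1) nz_iff by blast
    show ?thesis
    proof
      assume cl: "line_class l \<in> ?T closure_of ?A"
      show "satisfies_relations V l"
        unfolding satisfies_relations_def
      proof (intro conjI allI ballI impI l)
        fix d F assume F: "F \<in> hom_polys V d" "\<forall>x. F (eval_at V x) = 0"
        show "F l = 0"
        proof (rule ccontr)
          assume "F l \<noteq> 0"
          then have "line_class l \<in> nonvanishing ?X F"
            using nonvanishing_line_class[OF F(1)] lX by blast
          then obtain a where "a \<in> ?A" "a \<in> nonvanishing ?X F"
            using cl basic[OF F(1)] unfolding in_closure_of by blast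
          then show False using F(2) nonvanishing_line_class[OF F(1)] unfolding A by auto
        qed
      qed
    next
      assume rel: "satisfies_relations V l"
      show "line_class l \<in> ?T closure_of ?A"
        unfolding in_closure_of top
      proof (intro conjI lX allI impI)
        fix U assume U: "line_class l \<in> U \<and> openin ?T U"
        then obtain d F where F: "F \<in> hom_polys V d" "line_class l \<in> nonvanishing ?X F"
          "nonvanishing ?X F \<subseteq> U"
          using proj_topology_basis[of "hom_polys V" ?X U "line_class l"] hom_polys_mult by blast
        then have "F l \<noteq> 0" using nonvanishing_line_class by blast
        then obtain x where x: "eval_at V x \<noteq> 0" "F (eval_at V x) \<noteq> 0"
          using rel F(1) image_nz[OF F(1) _ y] unfolding satisfies_relations_def by blast
        then have "line_class (eval_at V x) \<in> ?A" unfolding A by blast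
        moreover from this have "line_class (eval_at V x) \<in> nonvanishing ?X F"
          using x AX nonvanishing_line_class[OF F(1)] by blast
        ultimately show "\<exists>y. y \<in> ?A \<and> y \<in> U" using F(3) by blast
      qed
    qed
  qed
  show ?thesis
  proof
    show "?T closure_of ?A \<subseteq> ?G"
    proof
      fix p assume p: "p \<in> ?T closure_of ?A"
      then have "p \<in> ?X" using closure_of_subset_topspace[of ?T ?A] unfolding top by (rule set_mp[rotated])
      then obtain l where "p = line_class l" "l \<in> dual_space V" "l \<noteq> 0"
        by (auto simp: proj_points_def)
      then show "p \<in> ?G" using key p by blast
    qed
    show "?G \<subseteq> ?T closure_of ?A" using key unfolding satisfies_relations_def by blast
  qed
qed

section \<open>Proj of an algebra generated in degree one\<close>

text \<open>The elements of the graded algebra \<open>R\<close> are functions on a space into which \<open>\<iota>\<close> maps the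
  source of the linear system \<open>V\<close>. Restriction along \<open>\<iota>\<close> is injective in every degree, the
  elements of \<open>V\<close> are restrictions of elements of degree \<open>1\<close>, and every restriction of an element
  of degree \<open>d\<close> is a homogeneous polynomial of degree \<open>d\<close> in the elements of \<open>V\<close>.\<close>

locale generated_in_degree_one =
  fixes V :: "('x \<Rightarrow> complex) set" and R :: "nat \<Rightarrow> ('y \<Rightarrow> complex) set" and \<iota> :: "'x \<Rightarrow> 'y"
  assumes subspace_V: "cfun.subspace V"
    and subspace_R: "\<And>d. cfun.subspace (R d)"
    and one_R: "1 \<in> R 0"
    and mult_R: "\<And>d e f g. f \<in> R d \<Longrightarrow> g \<in> R e \<Longrightarrow> f * g \<in> R (d + e)"
    and restrict_inj: "\<And>d s. s \<in> R d \<Longrightarrow> (\<And>x. s (\<iota> x) = 0) \<Longrightarrow> s = 0"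
    and extend: "\<And>f. f \<in> V \<Longrightarrow> \<exists>s\<in>R 1. \<forall>x. s (\<iota> x) = f x"
    and generated: "\<And>d s. s \<in> R d \<Longrightarrow> \<exists>F\<in>hom_polys V d. \<forall>x. s (\<iota> x) = F (eval_at V x)"
begin

text \<open>The graph of the surjection from the polynomials on the dual of \<open>V\<close> (the symmetric
  algebra of \<open>V\<close>) onto \<open>R\<close>.\<close>

definition represents :: "nat \<Rightarrow> ((('x \<Rightarrow> complex) \<Rightarrow> complex) \<Rightarrow> complex) \<Rightarrow> ('y \<Rightarrow> complex) \<Rightarrow> bool" where
  "represents d F s \<longleftrightarrow> F \<in> hom_polys V d \<and> s \<in> R d \<and> (\<forall>x. s (\<iota> x) = F (eval_at V x))"

lemma represents_ex: "s \<in> R d \<Longrightarrow> \<exists>F. represents d F s"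
  using generated unfolding represents_def by blast

lemma represents_add: "represents d F s \<Longrightarrow> represents d G t \<Longrightarrow> represents d (F + G) (s + t)"
  unfolding represents_def hom_polys_def
  by (auto simp: cfun.span_add cfun.subspace_add[OF subspace_R])

lemma represents_scale: "represents d F s \<Longrightarrow> represents d (fscale c F) (fscale c s)"
  unfolding represents_def hom_polys_def
  by (auto simp: cfun.span_scale cfun.subspace_scale[OF subspace_R]) (simp add: fscale_def)

lemma represents_mult: "represents d F s \<Longrightarrow> represents e G t \<Longrightarrow> represents (d + e) (F * G) (s * t)"
  unfolding represents_def by (auto simp: hom_polys_mult mult_R)

lemma represents_one: "represents 0 1 1"
  unfolding represents_def by (auto simp: hom_polys_one one_R)

lemma represents_zero: "represents d 0 0"
  unfolding represents_def hom_polys_def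
  by (auto simp: cfun.span_zero cfun.subspace_0[OF subspace_R])

lemma represents_unique: "represents d F s \<Longrightarrow> represents d F t \<Longrightarrow> s = t"
proof -
  assume r: "represents d F s" "represents d F t"
  have "represents d (F + fscale (-1) F) (s + fscale (-1) t)"
    using r by (intro represents_add represents_scale)
  then have "s + fscale (-1) t = 0"
    by (intro restrict_inj[of _ d]) (auto simp: represents_def fscale_def)
  then show "s = t" by (auto simp: fun_eq_iff fscale_def)
qed

lemma represents_linear: "f \<in> V \<Longrightarrow> \<exists>s. represents 1 (\<lambda>l. l f) s"
  using extend[of f] hom_polys_generator[of 1 "\<lambda>_. f" V]
  by (fastforce simp: represents_def eval_at_def)

text \<open>A function \<open>\<xi>\<close> on \<open>R\<close> that is multiplicative on products of elements of degree one is
  evaluation at the functional \<open>l\<close> that \<open>\<xi>\<close> induces on \<open>V\<close>; by linearity it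
  suffices to check this on monomials.\<close>

lemma represents_total:
  assumes "F \<in> hom_polys V d"
    and "\<And>c s t. s \<in> R d \<Longrightarrow> t \<in> R d \<Longrightarrow> \<xi> d (fscale c s + t) = c * \<xi> d s + \<xi> d t"
    and "\<xi> d 0 = 0"
    and "\<And>m. (\<And>j. j < d \<Longrightarrow> m j \<in> V) \<Longrightarrow>
           \<exists>s. represents d (\<lambda>x. \<Prod>j<d. x (m j)) s \<and> \<xi> d s = (\<Prod>j<d. l (m j))"
  shows "\<exists>s. represents d F s \<and> \<xi> d s = F l"
  using assms(1) unfolding hom_polys_def
proof (induction rule: cfun.span_induct_alt)
  case base
  show ?case using represents_zero[of d] assms(3) zero_fun_apply[of l] by metis
next
  case (step c x y)
  then obtain s where s: "represents d y s" "\<xi> d s = y l" by blast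
  obtain m where m: "x = (\<lambda>x. \<Prod>j<d. x (m j))" "\<And>j. j < d \<Longrightarrow> m j \<in> V"
    using step by auto
  then obtain t where t: "represents d x t" "\<xi> d t = x l" using assms(4)[of m] by auto
  have "represents d (fscale c x + y) (fscale c t + s)"
    using s t by (intro represents_add represents_scale)
  moreover have "\<xi> d (fscale c t + s) = (fscale c x + y) l"
    using assms(2)[of t s c] s t by (simp add: represents_def fscale_def)
  ultimately show ?case by blast
qed

lemma represents_prod:
  assumes "\<And>j. j < d \<Longrightarrow> m j \<in> V"
  shows "\<exists>s. represents d (\<lambda>x. \<Prod>j<d. x (m j)) s"
  using assms
proof (induction d)
  case 0
  then show ?case using represents_one by (auto simp: one_fun_def)
next
  case (Suc d)
  then obtain s where s: "represents d (\<lambda>x. \<Prod>j<d. x (m j)) s" by auto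
  obtain t where t: "represents 1 (\<lambda>l. l (m d)) t" using represents_linear Suc.prems by blast
  have eq: "(\<lambda>x. \<Prod>j<d. x (m j)) * (\<lambda>l. l (m d)) = (\<lambda>x. \<Prod>j<Suc d. x (m j))"
    by (auto simp: fun_eq_iff)
  have "represents (Suc d) (\<lambda>x. \<Prod>j<Suc d. x (m j)) (s * t)"
    using represents_mult[OF s t] unfolding eq Suc_eq_plus1[symmetric] .
  then show ?case by blast
qed

lemma represents_poly_ex:
  assumes "F \<in> hom_polys V d"
  shows "\<exists>s. represents d F s"
  using assms unfolding hom_polys_def
proof (induction rule: cfun.span_induct_alt)
  case base
  show ?case using represents_zero by blast
next
  case (step c x y)
  then obtain s where s: "represents d y s" by blast
  obtain m where m: "x = (\<lambda>x. \<Prod>j<d. x (m j))" "\<And>j. j < d \<Longrightarrow> m j \<in> V"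
    using step by auto
  then obtain t where "represents d x t" using represents_prod[of d m] by auto
  then have "represents d (fscale c x + y) (fscale c t + s)"
    using s by (intro represents_add represents_scale)
  then show ?case by blast
qed

text \<open>The character of \<open>R\<close> that extends the functional \<open>l\<close> on \<open>V\<close>: write an element of \<open>R\<close> as a
  polynomial in the elements of \<open>V\<close> and evaluate this polynomial at \<open>l\<close>.\<close>

definition character :: "(('x \<Rightarrow> complex) \<Rightarrow> complex) \<Rightarrow> nat \<Rightarrow> ('y \<Rightarrow> complex) \<Rightarrow> complex" where
  "character l = (\<lambda>d s. if s \<in> R d then (SOME F. represents d F s) l else 0)"

text \<open>Two polynomials that represent the same element differ by a relation, and \<open>l\<close> satisfies
  all relations; so the choice of the representing polynomial does not matter.\<close>

lemma character_eq:
  assumes l: "satisfies_relations V l" and r: "represents d F s"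
  shows "character l d s = F l"
proof -
  define G where "G = (SOME F. represents d F s)"
  have G: "represents d G s" unfolding G_def using r by (rule someI[of "\<lambda>F. represents d F s"])
  have "represents d (G + fscale (-1) F) (s + fscale (-1) s)"
    using G r by (intro represents_add represents_scale)
  moreover have "s + fscale (-1) s = 0" by (auto simp: fscale_def)
  ultimately have "(G + fscale (-1) F) l = 0"
    using l unfolding represents_def satisfies_relations_def by (metis zero_fun_apply)
  then have "G l = F l" by (simp add: fscale_def)
  then show ?thesis using r by (simp add: character_def G_def represents_def)
qed

lemma character_graded:
  assumes l: "satisfies_relations V l"
  shows "character l \<in> graded_characters R"
proof -
  have "character l d \<in> dual_space (R d)" for d
    unfolding dual_space_def
  proof (intro CollectI conjI allI ballI impI)
    fix f g assume "f \<in> R d" "g \<in> R d"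
    then obtain F G where "represents d F f" "represents d G g" using represents_ex by meson
    then show "character l d (f + g) = character l d f + character l d g"
      using character_eq[OF l] represents_add by (metis plus_fun_apply)
  next
    fix c f assume "f \<in> R d"
    then obtain F where F: "represents d F f" using represents_ex by meson
    show "character l d (fscale c f) = c * character l d f"
      using character_eq[OF l F] character_eq[OF l represents_scale[OF F]]
      by (simp add: fscale_def)
  qed (simp add: character_def)
  moreover have "character l 0 1 = 1"
    using character_eq[OF l represents_one] by simp
  moreover have "character l (d + e) (f * g) = character l d f * character l e g"
    if f: "f \<in> R d" and g: "g \<in> R e" for d e f g
  proof -
    obtain F where F: "represents d F f" using represents_ex[OF f] by blast
    obtain G where G: "represents e G g" using represents_ex[OF g] by blast
    show ?thesis
      unfolding character_eq[OF l F] character_eq[OF l G] character_eq[OF l represents_mult[OF F G]]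
      by (rule times_fun_apply)
  qed
  ultimately show ?thesis by (simp add: graded_characters_def)
qed

lemma character_scale:
  assumes l: "satisfies_relations V l" and c: "c \<noteq> 0"
  shows "satisfies_relations V (fscale c l)"
    and "character (fscale c l) = (\<lambda>d s. c ^ d * character l d s)"
proof -
  have "fscale c l \<noteq> 0" using l c unfolding satisfies_relations_def
    by (auto simp: fscale_def fun_eq_iff)
  then show 1: "satisfies_relations V (fscale c l)"
    using l unfolding satisfies_relations_def
    by (auto simp: dual_space_scale) (metis hom_polys_homogeneous mult_zero_right)
  have "character (fscale c l) d s = c ^ d * character l d s" for d s
  proof (cases "s \<in> R d")
    case True
    then obtain F where F: "represents d F s" using represents_ex by blast
    then have "F \<in> hom_polys V d" by (simp add: represents_def)
    from hom_polys_homogeneous[OF this] show ?thesis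
      using character_eq[OF l F] character_eq[OF 1 F] by simp
  qed (simp add: character_def)
  then show "character (fscale c l) = (\<lambda>d s. c ^ d * character l d s)" by blast
qed

lemma character_image_line:
  assumes "satisfies_relations V l"
  shows "character ` line_class l = graded_class (character l)"
  using character_scale(2)[OF assms] unfolding line_class_def graded_class_def by force

lemma character_inj:
  assumes l: "satisfies_relations V l" and l': "satisfies_relations V l'"
    and eq: "character l = character l'"
  shows "l = l'"
proof
  fix f show "l f = l' f"
  proof (cases "f \<in> V")
    case True
    then obtain s where s: "represents 1 (\<lambda>l. l f) s" using represents_linear by blast
    from character_eq[OF l this] character_eq[OF l' this] eq show ?thesis by simp
  next
    case False
    then show ?thesis using l l' dual_space_zero_outside unfolding satisfies_relations_def by metis
  qed
qed

text \<open>The functional is the restriction of \<open>\<xi>\<close> to degree one. It is nonzero: otherwise \<open>\<xi>\<close>, being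
  the evaluation of polynomials at \<open>0\<close>, would vanish in all positive degrees.\<close>

lemma character_surj:
  assumes \<xi>: "\<xi> \<in> graded_characters R" and nz: "d0 > 0" "f0 \<in> R d0" "\<xi> d0 f0 \<noteq> 0"
  shows "\<exists>l. satisfies_relations V l \<and> character l = \<xi>"
proof -
  have dual: "\<xi> d \<in> dual_space (R d)" for d using \<xi> by (simp add: graded_characters_def)
  have lin: "\<xi> d (fscale c s + t) = c * \<xi> d s + \<xi> d t" if "s \<in> R d" "t \<in> R d" for d c s t
    using dual[of d] that cfun.subspace_scale[OF subspace_R] unfolding dual_space_def by auto
  have \<xi>0: "\<xi> d 0 = 0" for d using dual_space_zero[OF dual subspace_R] .
  define l where "l f = (if f \<in> V then \<xi> 1 (SOME s. represents 1 (\<lambda>l. l f) s) else 0)" for f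
  have l_eq: "l f = \<xi> 1 s" if f: "f \<in> V" and s: "represents 1 (\<lambda>l. l f) s" for f s
  proof -
    have "represents 1 (\<lambda>l. l f) (SOME s. represents 1 (\<lambda>l. l f) s)"
      using s by (rule someI[of "\<lambda>s. represents 1 (\<lambda>l. l f) s"])
    then have "(SOME s. represents 1 (\<lambda>l. l f) s) = s"
      using represents_unique s by blast
    then show ?thesis using f by (simp add: l_def)
  qed
  have l_lin: "l (fscale c f + g) = c * l f + l g" if fg: "f \<in> V" "g \<in> V" for c f g
  proof -
    obtain s t where s: "represents 1 (\<lambda>l. l f) s" and t: "represents 1 (\<lambda>l. l g) t"
      using represents_linear fg by meson
    have V: "fscale c f + g \<in> V"
      using fg subspace_V by (simp add: cfun.subspace_add cfun.subspace_scale)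
    then obtain u where u: "represents 1 (\<lambda>l. l (fscale c f + g)) u"
      using represents_linear by meson
    have st: "represents 1 (fscale c (\<lambda>l. l f) + (\<lambda>l. l g)) (fscale c s + t)"
      using s t by (intro represents_add represents_scale)
    have "represents 1 (\<lambda>l. l (fscale c f + g)) (fscale c s + t)"
      using s t u st V fg unfolding represents_def
      by (auto simp: eval_at_def fscale_def)
    from l_eq[OF V this] l_eq[OF fg(1) s] l_eq[OF fg(2) t] show ?thesis
      using lin[of s 1 t c] s t by (simp add: represents_def)
  qed
  have V0: "0 \<in> V" by (rule cfun.subspace_0[OF subspace_V])
  have l0: "l 0 = 0"
    using l_lin[OF V0 V0, of 1] by (simp add: fscale_zero)
  have "l (f + g) = l f + l g" if "f \<in> V" "g \<in> V" for f g
    using l_lin[OF that, of 1] by (simp add: fscale_one)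
  moreover have "l (fscale c f) = c * l f" if "f \<in> V" for c f
    using l_lin[OF that, of 0 c] cfun.subspace_0[OF subspace_V] l0 by simp
  ultimately have ldual: "l \<in> dual_space V"
    unfolding dual_space_def by (auto simp: l_def)
  have prod: "\<exists>s. represents d (\<lambda>x. \<Prod>j<d. x (m j)) s \<and> \<xi> d s = (\<Prod>j<d. l (m j))"
    if "\<And>j. j < d \<Longrightarrow> m j \<in> V" for d m
    using that
  proof (induction d)
    case 0
    then show ?case using represents_one \<xi>
      by (auto simp: one_fun_def graded_characters_def intro!: exI[of _ 1])
  next
    case (Suc d)
    then obtain s where s: "represents d (\<lambda>x. \<Prod>j<d. x (m j)) s" "\<xi> d s = (\<Prod>j<d. l (m j))"
      by auto
    obtain t where t: "represents 1 (\<lambda>l. l (m d)) t" using represents_linear Suc.prems by blast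
    have eq: "(\<lambda>x. \<Prod>j<d. x (m j)) * (\<lambda>l. l (m d)) = (\<lambda>x. \<Prod>j<Suc d. x (m j))"
      by (auto simp: fun_eq_iff)
    have st: "represents (Suc d) (\<lambda>x. \<Prod>j<Suc d. x (m j)) (s * t)"
      using represents_mult[OF s(1) t] unfolding eq Suc_eq_plus1[symmetric] .
    have "\<xi> (d + 1) (s * t) = \<xi> d s * \<xi> 1 t"
      using \<xi> s(1) t unfolding graded_characters_def represents_def by blast
    then have "\<xi> (Suc d) (s * t) = (\<Prod>j<Suc d. l (m j))"
      using s(2) l_eq[OF Suc.prems t] by (simp only: Suc_eq_plus1[symmetric] prod.lessThan_Suc lessI)
    with st show ?case by blast
  qed
  have ex: "\<exists>s. represents d F s \<and> \<xi> d s = F l" if "F \<in> hom_polys V d" for d F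
    by (rule represents_total[where \<xi> = \<xi> and d = d and l = l, OF that lin \<xi>0 prod])
  have val: "\<xi> d s = F l" if r: "represents d F s" for d F s
    using ex[of F d] r represents_unique unfolding represents_def by (metis r represents_unique)
  have rel: "F l = 0" if F: "F \<in> hom_polys V d" "\<forall>x. F (eval_at V x) = 0" for d F
  proof -
    have "represents d F 0"
      using F cfun.subspace_0[OF subspace_R] by (simp add: represents_def)
    from val[OF this] show ?thesis using \<xi>0 by simp
  qed
  have "l \<noteq> 0"
  proof
    assume "l = 0"
    obtain F where F: "represents d0 F f0" using represents_ex nz by blast
    then have "F 0 = 0" using hom_polys_zero_pos nz(1) unfolding represents_def by blast
    then show False using val[OF F] nz(3) \<open>l = 0\<close> by simp
  qed
  then have l: "satisfies_relations V l"
    unfolding satisfies_relations_def using ldual rel by blast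
  have "character l d s = \<xi> d s" for d s
  proof (cases "s \<in> R d")
    case True
    then obtain F where F: "represents d F s" using represents_ex by blast
    then show ?thesis using character_eq[OF l F] val[OF F] by simp
  next
    case False
    then show ?thesis using dual_space_zero_outside[OF dual] by (simp add: character_def)
  qed
  with l show ?thesis by blast
qed

text \<open>Functionals that satisfy the relations and graded characters correspond bijectively, and
  a polynomial takes the same value at a functional as the element it represents takes at the
  corresponding character.\<close>

theorem closure_of_image_iso_Proj:
  "variety_iso
     (closed_subvariety V
        (proj_topology (proj_points V) (hom_polys V) closure_of linear_system_image V))
     (Proj R) (image character)"
  unfolding closed_subvariety_def Proj_def closure_of_linear_system_image[OF subspace_V]
proof (rule variety_iso_of_cone_map)
  let ?X = "{line_class l | l. satisfies_relations V l}"
  have mem: "satisfies_relations V x" if "p \<in> ?X" "x \<in> p" for p x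
    using that character_scale(1) by (auto simp: line_class_def)
  show "bij_betw (image character) ?X (Proj_points R)"
    unfolding bij_betw_def
  proof
    show "inj_on (image character) ?X"
    proof (rule inj_onI)
      fix p q assume pq: "p \<in> ?X" "q \<in> ?X" "character ` p = character ` q"
      then obtain l where l: "p = line_class l" "satisfies_relations V l" by blast
      from pq(2) obtain l' where l': "q = line_class l'" by blast
      have "character l \<in> character ` q" using pq(3) l(1) line_class_self by blast
      then obtain m where m: "m \<in> q" "character l = character m" by blast
      then have "l = m" using character_inj[OF l(2)] mem[OF pq(2)] by blast
      then show "p = q" using line_class_eqI m(1) l' l(1) by metis
    qed
    show "image character ` ?X = Proj_points R"
    proof (intro equalityI subsetI)
      fix P assume "P \<in> image character ` ?X"
      then obtain l where l: "satisfies_relations V l" "P = graded_class (character l)"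
        using character_image_line by auto
      then have "\<exists>f\<in>V. l f \<noteq> 0"
        unfolding satisfies_relations_def
        using dual_space_zero_outside[of l V] by (auto simp: fun_eq_iff)
      then obtain f where f: "f \<in> V" "l f \<noteq> 0" by blast
      then obtain s where s: "represents 1 (\<lambda>l. l f) s" using represents_linear by blast
      then have "character l 1 s \<noteq> 0" "s \<in> R 1"
        using character_eq[OF l(1) s] f by (auto simp: represents_def)
      then show "P \<in> Proj_points R"
        unfolding Proj_points_def using l(2) character_graded[OF l(1)] zero_less_one by blast
    next
      fix P assume "P \<in> Proj_points R"
      then obtain \<xi> d f where \<xi>: "P = graded_class \<xi>" "\<xi> \<in> graded_characters R"
        "d > 0" "f \<in> R d" "\<xi> d f \<noteq> 0"
        unfolding Proj_points_def by blast
      then obtain l where l: "satisfies_relations V l" "character l = \<xi>"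
        using character_surj by blast
      then have "P = character ` line_class l" using character_image_line \<xi>(1) by simp
      then show "P \<in> image character ` ?X" using l(1) by blast
    qed
  qed
  show "\<exists>G\<in>{\<lambda>\<xi>. \<xi> d f |f. f \<in> R d}. \<forall>p\<in>?X. \<forall>x\<in>p. G (character x) = F x"
    if F: "F \<in> hom_polys V d" for d F
  proof -
    obtain s where s: "represents d F s" using represents_poly_ex[OF F] by blast
    then show ?thesis
      using character_eq[OF mem s] by (intro bexI[of _ "\<lambda>\<xi>. \<xi> d s"]) (auto simp: represents_def)
  qed
  show "\<exists>F\<in>hom_polys V d. \<forall>p\<in>?X. \<forall>x\<in>p. G (character x) = F x"
    if G: "G \<in> {\<lambda>\<xi>. \<xi> d f |f. f \<in> R d}" for d G
  proof -
    obtain s where s: "G = (\<lambda>\<xi>. \<xi> d s)" "s \<in> R d" using G by blast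
    then obtain F where F: "represents d F s" using represents_ex by blast
    then show ?thesis
      using character_eq[OF mem F] s by (intro bexI[of _ F]) (auto simp: represents_def)
  qed
qed

end

section \<open>Brackets and multihomogeneous polynomials\<close>

definition bracket :: "complex^2 \<Rightarrow> complex^2 \<Rightarrow> complex" where
  "bracket u v = u $ 1 * v $ 2 - u $ 2 * v $ 1"

lemma bracket_linear: "bracket (A *v u) (A *v v) = det A * bracket u v"
  by (simp add: bracket_def matrix_vector_mult_def sum_2 det_2 algebra_simps)

lemma bracket_self [simp]: "bracket u u = 0"
  by (simp add: bracket_def)

lemma bracket_swap: "bracket u v = - bracket v u"
  by (simp add: bracket_def)

lemma bracket_plucker:
  "bracket a b * bracket c d = bracket a c * bracket b d + bracket a d * bracket c b"
  by (simp add: bracket_def algebra_simps)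

definition monomial :: "nat \<Rightarrow> (nat \<Rightarrow> nat) \<Rightarrow> (nat \<Rightarrow> nat) \<Rightarrow> (nat \<Rightarrow> complex^2) \<Rightarrow> complex" where
  "monomial n D e = (\<lambda>p. \<Prod>i=1..n. (p i $ 1) ^ e i * (p i $ 2) ^ (D i - e i))"

text \<open>The polynomials that are homogeneous of degree \<open>D i\<close> in the \<open>i\<close>-th of \<open>n\<close> vectors. The
  degrees vary with the vector because merging vectors and dividing by brackets lead out
  of the case of constant degree.\<close>

definition multihom :: "nat \<Rightarrow> (nat \<Rightarrow> nat) \<Rightarrow> ((nat \<Rightarrow> complex^2) \<Rightarrow> complex) set" where
  "multihom n D = cfun.span {monomial n D e | e. \<forall>i\<in>{1..n}. e i \<le> D i}"

lemma sections_O_multihom: "sections_O n d = multihom n (\<lambda>_. d)"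
  by (simp add: sections_O_def multihom_def monomial_def)

lemma monomial_in_multihom: "(\<And>i. i \<in> {1..n} \<Longrightarrow> e i \<le> D i) \<Longrightarrow> monomial n D e \<in> multihom n D"
  unfolding multihom_def by (intro cfun.span_base CollectI exI[of _ e]) blast

lemma monomial_cong:
  "(\<And>i. i \<in> {1..n} \<Longrightarrow> D i = D' i) \<Longrightarrow> (\<And>i. i \<in> {1..n} \<Longrightarrow> e i = e' i) \<Longrightarrow>
   monomial n D e = monomial n D' e'"
  unfolding monomial_def by (intro ext prod.cong) auto

lemma monomial_Suc:
  "monomial (Suc n) D e p =
     monomial n D e p * ((p (Suc n) $ 1) ^ e (Suc n) * (p (Suc n) $ 2) ^ (D (Suc n) - e (Suc n)))"
  by (simp add: monomial_def)

lemma multihom_cong: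
  assumes "\<And>i. i \<in> {1..n} \<Longrightarrow> D i = D' i"
  shows "multihom n D = multihom n D'"
proof -
  have "monomial n D e = monomial n D' e" for e
    by (intro monomial_cong assms refl)
  moreover have "(\<forall>i\<in>{1..n}. e i \<le> D i) \<longleftrightarrow> (\<forall>i\<in>{1..n}. e i \<le> D' i)" for e
    by (intro ball_cong refl) (simp add: assms)
  ultimately show ?thesis unfolding multihom_def by presburger
qed

lemma multihom_mult:
  assumes "f \<in> multihom n D" "g \<in> multihom n D'"
  shows "f * g \<in> multihom n (\<lambda>i. D i + D' i)"
  using assms unfolding multihom_def
proof (rule span_mult_closed)
  fix a b
  assume "a \<in> {monomial n D e | e. \<forall>i\<in>{1..n}. e i \<le> D i}"
    and "b \<in> {monomial n D' e | e. \<forall>i\<in>{1..n}. e i \<le> D' i}"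
  then obtain e e' where e: "a = monomial n D e" "\<forall>i\<in>{1..n}. e i \<le> D i"
    and e': "b = monomial n D' e'" "\<forall>i\<in>{1..n}. e' i \<le> D' i" by blast
  have "a p * b p = monomial n (\<lambda>i. D i + D' i) (\<lambda>i. e i + e' i) p" for p
    unfolding e(1) e'(1) monomial_def prod.distrib[symmetric]
  proof (intro prod.cong refl)
    fix i assume "i \<in> {1..n}"
    then have "D i + D' i - (e i + e' i) = (D i - e i) + (D' i - e' i)"
      using e(2) e'(2) by (metis add_diff_assoc2 diff_add_assoc diff_diff_left)
    then show "p i $ 1 ^ e i * p i $ 2 ^ (D i - e i) * (p i $ 1 ^ e' i * p i $ 2 ^ (D' i - e' i)) =
        p i $ 1 ^ (e i + e' i) * p i $ 2 ^ (D i + D' i - (e i + e' i))"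
      by (simp add: power_add)
  qed
  then have "a * b = monomial n (\<lambda>i. D i + D' i) (\<lambda>i. e i + e' i)"
    by (intro ext) (simp only: times_fun_apply)
  moreover have "\<dots> \<in> multihom n (\<lambda>i. D i + D' i)"
    using e(2) e'(2) by (intro monomial_in_multihom add_mono) auto
  ultimately show "a * b \<in> cfun.span {monomial n (\<lambda>i. D i + D' i) e | e.
      \<forall>i\<in>{1..n}. e i \<le> D i + D' i}"
    unfolding multihom_def by simp
qed

lemma multihom_one: "1 \<in> multihom n (\<lambda>_. 0)"
proof -
  have "monomial n (\<lambda>_. 0) (\<lambda>_. 0) = 1"
    by (rule ext) (simp add: monomial_def)
  then show ?thesis using monomial_in_multihom[of n "\<lambda>_. 0" "\<lambda>_. 0"] by simp
qed

lemma multihom_tendsto: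
  assumes "f \<in> multihom n D" and "\<And>i. ((\<lambda>t. \<gamma> t i) \<longlongrightarrow> p i) F"
  shows "((\<lambda>t. f (\<gamma> t)) \<longlongrightarrow> f p) F"
  using assms(1) unfolding multihom_def
proof (induction rule: cfun.span_induct_alt)
  case base
  show ?case by simp
next
  case (step c m g)
  then obtain e where "m = monomial n D e" by blast
  then have "((\<lambda>t. m (\<gamma> t)) \<longlongrightarrow> m p) F"
    unfolding monomial_def by (auto intro!: tendsto_intros assms(2))
  with step.IH show ?case by (auto simp: fscale_def intro!: tendsto_intros)
qed

lemma multihom_local:
  assumes "f \<in> multihom n D" "\<And>i. i \<in> {1..n} \<Longrightarrow> p i = q i"
  shows "f p = f q"
  using assms(1) unfolding multihom_def
proof (induction rule: cfun.span_induct_alt)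
  case (step c m g)
  then obtain e where "m = monomial n D e" by blast
  then have "m p = m q"
    unfolding monomial_def by (auto intro!: prod.cong simp: assms(2))
  with step.IH show ?case by (simp add: fscale_def)
qed simp

text \<open>Products of brackets are indexed by multigraphs: an edge from \<open>i\<close> to \<open>j\<close> is the bracket of the
  vectors \<open>i\<close> and \<open>j\<close>, and the degree of a vertex is the degree of the product in that vector.\<close>

definition bracket_monomial :: "(nat \<times> nat) multiset \<Rightarrow> (nat \<Rightarrow> complex^2) \<Rightarrow> complex" where
  "bracket_monomial E p = (\<Prod>(i, j)\<in>#E. bracket (p i) (p j))"

definition deg :: "(nat \<times> nat) multiset \<Rightarrow> nat \<Rightarrow> nat" where
  "deg E v = count (image_mset fst E + image_mset snd E) v"

lemma bracket_monomial_empty [simp]: "bracket_monomial {#} p = 1"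
  by (simp add: bracket_monomial_def)

lemma bracket_monomial_add [simp]:
  "bracket_monomial (add_mset e E) p = bracket (p (fst e)) (p (snd e)) * bracket_monomial E p"
  by (simp add: bracket_monomial_def case_prod_beta)

lemma bracket_monomial_union [simp]:
  "bracket_monomial (E + E') p = bracket_monomial E p * bracket_monomial E' p"
  by (simp add: bracket_monomial_def)

lemma deg_empty [simp]: "deg {#} v = 0"
  by (simp add: deg_def)

lemma deg_add [simp]:
  "deg (add_mset e E) v = of_bool (fst e = v) + of_bool (snd e = v) + deg E v"
  by (simp add: deg_def)

lemma deg_union [simp]: "deg (E + E') v = deg E v + deg E' v"
  by (simp add: deg_def)

lemma bracket_monomial_linear:
  "bracket_monomial E (\<lambda>i. A *v p i) = det A ^ size E * bracket_monomial E p"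
  by (induction E) (simp_all add: bracket_linear)

lemma sum_deg:
  assumes "finite S" "set_mset E \<subseteq> S \<times> S"
  shows "(\<Sum>v\<in>S. deg E v) = 2 * size E"
  using assms(2)
proof (induction E)
  case (add e E)
  then have "fst e \<in> S" "snd e \<in> S" by auto
  then have "(\<Sum>v\<in>S. of_bool (fst e = v)) = (1::nat)" "(\<Sum>v\<in>S. of_bool (snd e = v)) = (1::nat)"
    using assms(1) by (simp_all add: of_bool_def)
  then show ?case using add by (simp add: sum.distrib)
qed simp

lemma bracket_multihom:
  assumes i: "i \<in> {1..n}" and j: "j \<in> {1..n}"
  shows "(\<lambda>p. bracket (p i) (p j)) \<in> multihom n (\<lambda>v. of_bool (i = v) + of_bool (j = v))"
proof (cases "i = j")
  case True
  then have "(\<lambda>p. bracket (p i) (p j)) = 0" by (simp add: fun_eq_iff)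
  then show ?thesis unfolding multihom_def using cfun.span_zero by metis
next
  case False
  let ?D = "\<lambda>v. of_bool (i = v) + of_bool (j = v) :: nat"
  have mon: "monomial n ?D (\<lambda>v. of_bool (a = v)) p = p a $ 1 * p b $ 2"
    if ab: "{a, b} = {i, j}" "a \<noteq> b" for a b p
  proof -
    have D: "?D v = of_bool (v = a) + of_bool (v = b)" for v
      using ab False by (auto simp: doubleton_eq_iff)
    have "monomial n ?D (\<lambda>v. of_bool (a = v)) p =
        (\<Prod>v\<in>{a, b}. p v $ 1 ^ of_bool (a = v) * p v $ 2 ^ (?D v - of_bool (a = v)))"
      unfolding monomial_def
    proof (rule prod.mono_neutral_right)
      show "{a, b} \<subseteq> {1..n}" unfolding ab(1) using i j by blast
    qed (auto simp: D)
    then show ?thesis using ab(2) by (simp add: D)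
  qed
  have "(\<lambda>p. bracket (p i) (p j)) =
      monomial n ?D (\<lambda>v. of_bool (i = v)) + fscale (-1) (monomial n ?D (\<lambda>v. of_bool (j = v)))"
    using mon[of i j] mon[of j i] False
    by (auto simp: fun_eq_iff bracket_def fscale_def insert_commute)
  moreover have "\<dots> \<in> multihom n ?D"
    unfolding multihom_def
    by (intro cfun.span_add cfun.span_scale) (intro monomial_in_multihom[unfolded multihom_def]; simp)+
  ultimately show ?thesis by (simp only:)
qed

lemma bracket_monomial_multihom:
  assumes "set_mset E \<subseteq> {1..n} \<times> {1..n}"
  shows "bracket_monomial E \<in> multihom n (deg E)"
  using assms
proof (induction E)
  case empty
  have "bracket_monomial {#} = 1" "deg {#} = (\<lambda>_. 0)" by (auto simp: fun_eq_iff)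
  then show ?case using multihom_one by metis
next
  case (add e E)
  have 1: "bracket_monomial (add_mset e E) =
      (\<lambda>p. bracket (p (fst e)) (p (snd e))) * bracket_monomial E"
    by (rule ext) (simp only: times_fun_apply bracket_monomial_add)
  have 2: "deg (add_mset e E) = (\<lambda>v. of_bool (fst e = v) + of_bool (snd e = v) + deg E v)"
    by (rule ext) simp
  show ?case
    unfolding 1 2 using add by (intro multihom_mult bracket_multihom add.IH) auto
qed

definition bracket_span :: "nat \<Rightarrow> (nat \<Rightarrow> nat) \<Rightarrow> ((nat \<Rightarrow> complex^2) \<Rightarrow> complex) set" where
  "bracket_span n D = cfun.span {bracket_monomial E | E.
     set_mset E \<subseteq> {1..n} \<times> {1..n} \<and> (\<forall>v\<in>{1..n}. deg E v = D v)}"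

lemma bracket_monomial_in_span:
  "set_mset E \<subseteq> {1..n} \<times> {1..n} \<Longrightarrow> (\<And>v. v \<in> {1..n} \<Longrightarrow> deg E v = D v) \<Longrightarrow>
   bracket_monomial E \<in> bracket_span n D"
  unfolding bracket_span_def by (intro cfun.span_base CollectI exI[of _ E]) blast

lemma bracket_span_multihom: "bracket_span n D \<subseteq> multihom n D"
  unfolding bracket_span_def
proof (rule cfun.span_minimal)
  show "cfun.subspace (multihom n D)" by (simp add: multihom_def)
  show "{bracket_monomial E | E. set_mset E \<subseteq> {1..n} \<times> {1..n} \<and> (\<forall>v\<in>{1..n}. deg E v = D v)}
      \<subseteq> multihom n D"
    using bracket_monomial_multihom multihom_cong by blast
qed

lemma bracket_span_semi_invariant:
  assumes "h \<in> bracket_span n D" "(\<Sum>v=1..n. D v) = 2 * w"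
  shows "h (\<lambda>i. A *v p i) = det A ^ w * h p"
  using assms(1) unfolding bracket_span_def
proof (induction rule: cfun.span_induct_alt)
  case (step c m g)
  then obtain E where E: "m = bracket_monomial E" "set_mset E \<subseteq> {1..n} \<times> {1..n}"
    "\<forall>v\<in>{1..n}. deg E v = D v" by blast
  have "2 * size E = (\<Sum>v=1..n. deg E v)" by (rule sum_deg[OF _ E(2), symmetric]) simp
  also have "\<dots> = 2 * w" unfolding assms(2)[symmetric] using E(3) by (intro sum.cong) auto
  finally have "size E = w" by simp
  then have "m (\<lambda>i. A *v p i) = det A ^ w * m p"
    unfolding E(1) bracket_monomial_linear by simp
  with step.IH show ?case by (simp add: fscale_def algebra_simps)
qed simp

text \<open>Modulo the bracket \<open>x v - y u\<close> of \<open>(x, y)\<close> and \<open>(u, v)\<close>, the products \<open>y u\<close> and \<open>x v\<close> agree. So a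
  factor \<open>y\<close> of the first vector can be exchanged for \<open>x\<close> when a factor \<open>u\<close> of the second
  is exchanged for \<open>v\<close>; the total degree in \<open>x\<close> and \<open>u\<close> does not change.\<close>

lemma divide_monomial_by_bracket:
  fixes x y u v :: complex
  assumes "e < a" "0 < j" "j \<le> b"
  shows "x ^ e * y ^ (a - e) * (u ^ j * v ^ (b - j)) =
      x ^ Suc e * y ^ (a - Suc e) * (u ^ (j - 1) * v ^ (b - (j - 1))) -
      (x * v - y * u) * (x ^ e * y ^ (a - 1 - e) * (u ^ (j - 1) * v ^ (b - 1 - (j - 1))))"
proof -
  obtain a' where a: "a = Suc (e + a')" using assms(1) less_iff_Suc_add by auto
  obtain j' where j: "j = Suc j'" using assms(2) gr0_implies_Suc by blast
  obtain b' where b: "b = Suc (j' + b')" using assms(3) j by (metis Suc_le_D Suc_le_mono le_Suc_ex)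
  show ?thesis unfolding a b j by (simp add: algebra_simps)
qed

text \<open>The normal form modulo the bracket of the monomials with total degree \<open>t\<close> in the two first
  coordinates: as much of \<open>t\<close> as possible is assigned to the first vector.\<close>

definition pair_monomial :: "nat \<Rightarrow> nat \<Rightarrow> nat \<Rightarrow> complex^2 \<Rightarrow> complex^2 \<Rightarrow> complex" where
  "pair_monomial a b t p q =
     (let e = min a t; j = t - e
      in p $ 1 ^ e * p $ 2 ^ (a - e) * (q $ 1 ^ j * q $ 2 ^ (b - j)))"

text \<open>Exchanging coordinates repeatedly brings a monomial into normal form. An exchange takes place
  only if both vectors occur with positive degree, so the quotient is \<open>0\<close> when one of the
  degrees is; this must be recorded, as \<open>D'\<close> is not the right degree in this case.\<close>

lemma monomial_mod_bracket:
  assumes "\<And>i. i \<in> {1..n} \<Longrightarrow> e i \<le> D i" "r \<le> D (Suc n)" "j \<le> D (Suc (Suc n))"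
  defines "D' \<equiv> D(Suc n := D (Suc n) - 1, Suc (Suc n) := D (Suc (Suc n)) - 1)"
  shows "\<exists>g\<in>multihom (Suc (Suc n)) D'. (D (Suc n) = 0 \<or> D (Suc (Suc n)) = 0 \<longrightarrow> g = 0) \<and>
     (\<forall>p. monomial (Suc (Suc n)) D (e(Suc n := r, Suc (Suc n) := j)) p =
        monomial n D e p *
          pair_monomial (D (Suc n)) (D (Suc (Suc n))) (r + j) (p (Suc n)) (p (Suc (Suc n))) +
        bracket (p (Suc n)) (p (Suc (Suc n))) * g p)"
  using assms(2,3)
proof (induction "min (D (Suc n)) (r + j) - r" arbitrary: r j)
  case 0
  then have "r = min (D (Suc n)) (r + j)" by simp
  then have "pair_monomial (D (Suc n)) (D (Suc (Suc n))) (r + j) p q =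
      p $ 1 ^ r * p $ 2 ^ (D (Suc n) - r) * (q $ 1 ^ j * q $ 2 ^ (D (Suc (Suc n)) - j))" for p q
    by (simp add: pair_monomial_def Let_def)
  moreover have "monomial n D (e(Suc n := r, Suc (Suc n) := j)) = monomial n D e"
    by (rule monomial_cong) auto
  ultimately have "monomial (Suc (Suc n)) D (e(Suc n := r, Suc (Suc n) := j)) p =
      monomial n D e p *
        pair_monomial (D (Suc n)) (D (Suc (Suc n))) (r + j) (p (Suc n)) (p (Suc (Suc n))) +
      bracket (p (Suc n)) (p (Suc (Suc n))) * 0 p" for p
    unfolding monomial_Suc by simp
  moreover have "0 \<in> multihom (Suc (Suc n)) D'" by (simp only: multihom_def cfun.span_zero)
  ultimately show ?case by (intro bexI[of _ 0] conjI allI impI refl)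
next
  case (Suc m)
  let ?a = "D (Suc n)" and ?b = "D (Suc (Suc n))"
  have r: "r < ?a" "0 < j" using Suc(2) by auto
  have "m = min ?a (Suc r + (j - 1)) - Suc r" "Suc r \<le> ?a" "j - 1 \<le> ?b" "Suc r + (j - 1) = r + j"
    using Suc(2,4) r by auto
  from Suc(1)[OF this(1-3)] this(4) obtain g where g: "g \<in> multihom (Suc (Suc n)) D'"
    and eq: "\<And>p. monomial (Suc (Suc n)) D (e(Suc n := Suc r, Suc (Suc n) := j - 1)) p =
        monomial n D e p * pair_monomial ?a ?b (r + j) (p (Suc n)) (p (Suc (Suc n))) +
        bracket (p (Suc n)) (p (Suc (Suc n))) * g p" by metis
  let ?e = "e(Suc n := r, Suc (Suc n) := j - 1)"
  define g' where "g' = g + fscale (-1) (monomial (Suc (Suc n)) D' ?e)"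
  have "monomial (Suc (Suc n)) D' ?e \<in> multihom (Suc (Suc n)) D'"
    using assms(1) r Suc(4) by (intro monomial_in_multihom) (auto simp: D'_def)
  then have g': "g' \<in> multihom (Suc (Suc n)) D'"
    using g unfolding g'_def multihom_def by (intro cfun.span_add cfun.span_scale)
  have m: "monomial n D (e(Suc n := c, Suc (Suc n) := d)) = monomial n D e"
    "monomial n D' (e(Suc n := c, Suc (Suc n) := d)) = monomial n D e" for c d
    by (rule monomial_cong; auto simp: D'_def)+
  have "monomial (Suc (Suc n)) D (e(Suc n := r, Suc (Suc n) := j)) p =
      monomial (Suc (Suc n)) D (e(Suc n := Suc r, Suc (Suc n) := j - 1)) p -
      bracket (p (Suc n)) (p (Suc (Suc n))) * monomial (Suc (Suc n)) D' ?e p" for p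
  proof -
    have D': "D' (Suc n) = ?a - 1" "D' (Suc (Suc n)) = ?b - 1" by (simp_all add: D'_def)
    note key = divide_monomial_by_bracket[OF r Suc(4), of "p (Suc n) $ 1" "p (Suc n) $ 2"
        "p (Suc (Suc n)) $ 1" "p (Suc (Suc n)) $ 2"]
    show ?thesis
      using arg_cong[OF key, of "\<lambda>z. monomial n D e p * z"]
      unfolding monomial_Suc m D' bracket_def by (simp add: algebra_simps)
  qed
  then have "monomial (Suc (Suc n)) D (e(Suc n := r, Suc (Suc n) := j)) p =
        monomial n D e p * pair_monomial ?a ?b (r + j) (p (Suc n)) (p (Suc (Suc n))) +
        bracket (p (Suc n)) (p (Suc (Suc n))) * g' p" for p
    unfolding eq g'_def by (simp add: fscale_def algebra_simps)
  moreover have "?a = 0 \<or> ?b = 0 \<longrightarrow> g' = 0" using r Suc(4) by auto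
  ultimately show ?case using g' by (intro bexI[of _ g'] conjI allI)
qed

text \<open>Division with remainder by the bracket of the last two vectors: the quotient is \<open>g\<close>, and the
  remainder is a combination of normal forms with coefficients \<open>C\<close> in the other vectors.\<close>

definition bracket_division ::
    "nat \<Rightarrow> (nat \<Rightarrow> nat) \<Rightarrow> ((nat \<Rightarrow> complex^2) \<Rightarrow> complex) \<Rightarrow>
      (nat \<Rightarrow> (nat \<Rightarrow> complex^2) \<Rightarrow> complex) \<Rightarrow> ((nat \<Rightarrow> complex^2) \<Rightarrow> complex) \<Rightarrow> bool" where
  "bracket_division n D f C g \<longleftrightarrow>
     g \<in> multihom (Suc (Suc n)) (D(Suc n := D (Suc n) - 1, Suc (Suc n) := D (Suc (Suc n)) - 1)) \<and>
     (D (Suc n) = 0 \<or> D (Suc (Suc n)) = 0 \<longrightarrow> g = 0) \<and>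
     (\<forall>t p q. (\<forall>i\<in>{1..n}. p i = q i) \<longrightarrow> C t p = C t q) \<and>
     (\<forall>p. f p = (\<Sum>t\<le>D (Suc n) + D (Suc (Suc n)). C t p *
            pair_monomial (D (Suc n)) (D (Suc (Suc n))) t (p (Suc n)) (p (Suc (Suc n)))) +
          bracket (p (Suc n)) (p (Suc (Suc n))) * g p)"

lemma bracket_division_exists:
  assumes "f \<in> multihom (Suc (Suc n)) D"
  shows "\<exists>C g. bracket_division n D f C g"
  using assms unfolding multihom_def
proof (induction rule: cfun.span_induct_alt)
  case base
  have "0 \<in> multihom (Suc (Suc n)) (D(Suc n := D (Suc n) - 1, Suc (Suc n) := D (Suc (Suc n)) - 1))"
    by (simp only: multihom_def cfun.span_zero)
  then have "bracket_division n D 0 (\<lambda>_ _. 0) 0"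
    unfolding bracket_division_def by simp
  then show ?case by blast
next
  case (step c m f)
  let ?a = "D (Suc n)" and ?b = "D (Suc (Suc n))"
  let ?D' = "D(Suc n := D (Suc n) - 1, Suc (Suc n) := D (Suc (Suc n)) - 1)"
  obtain e where e: "m = monomial (Suc (Suc n)) D e" "\<forall>i\<in>{1..Suc (Suc n)}. e i \<le> D i"
    using step by blast
  have le: "\<And>i. i \<in> {1..n} \<Longrightarrow> e i \<le> D i" using e(2) by auto
  have le': "e (Suc n) \<le> ?a" "e (Suc (Suc n)) \<le> ?b" using e(2) by auto
  define t0 where "t0 = e (Suc n) + e (Suc (Suc n))"
  have "\<exists>g\<in>multihom (Suc (Suc n)) ?D'. (?a = 0 \<or> ?b = 0 \<longrightarrow> g = 0) \<and>
     (\<forall>p. monomial (Suc (Suc n)) D (e(Suc n := e (Suc n), Suc (Suc n) := e (Suc (Suc n)))) p =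
        monomial n D e p * pair_monomial ?a ?b t0 (p (Suc n)) (p (Suc (Suc n))) +
        bracket (p (Suc n)) (p (Suc (Suc n))) * g p)"
    unfolding t0_def by (intro monomial_mod_bracket le le')
  then obtain g where g1: "g \<in> multihom (Suc (Suc n)) ?D'"
    and g2: "(?a = 0 \<or> ?b = 0 \<longrightarrow> g = 0) \<and>
     (\<forall>p. monomial (Suc (Suc n)) D e p =
        monomial n D e p * pair_monomial ?a ?b t0 (p (Suc n)) (p (Suc (Suc n))) +
        bracket (p (Suc n)) (p (Suc (Suc n))) * g p)"
    unfolding fun_upd_triv by (rule bexE)
  have g: "g \<in> multihom (Suc (Suc n)) ?D'" "?a = 0 \<or> ?b = 0 \<longrightarrow> g = 0" using g1 g2 by blast+
  have m: "\<forall>p. m p = monomial n D e p * pair_monomial ?a ?b t0 (p (Suc n)) (p (Suc (Suc n))) +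
      bracket (p (Suc n)) (p (Suc (Suc n))) * g p"
    using g2 unfolding e(1) by (rule conjunct2)
  obtain C g1 where "bracket_division n D f C g1" using step.IH by blast
  note div = this[unfolded bracket_division_def]
  have g1: "g1 \<in> multihom (Suc (Suc n)) ?D'" "?a = 0 \<or> ?b = 0 \<longrightarrow> g1 = 0" using div by blast+
  have C: "C t p = C t q" if "\<forall>i\<in>{1..n}. p i = q i" for t p q using div that by blast
  have f: "\<forall>p. f p = (\<Sum>t\<le>?a + ?b. C t p * pair_monomial ?a ?b t (p (Suc n)) (p (Suc (Suc n)))) +
      bracket (p (Suc n)) (p (Suc (Suc n))) * g1 p" using div by (elim conjE)
  define C' where "C' t p = (if t = t0 then c * monomial n D e p else 0) + C t p" for t p
  define g' where "g' = fscale c g + g1"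
  have "g' \<in> multihom (Suc (Suc n)) ?D'"
    using g(1) g1(1) unfolding g'_def multihom_def by (intro cfun.span_add cfun.span_scale)
  moreover have "?a = 0 \<or> ?b = 0 \<longrightarrow> g' = 0"
    using g(2) g1(2) by (auto simp: g'_def fscale_def fun_eq_iff)
  moreover have "C' t p = C' t q" if "\<forall>i\<in>{1..n}. p i = q i" for t p q
  proof -
    have "monomial n D e p = monomial n D e q"
      using that by (intro multihom_local[OF monomial_in_multihom] le) auto
    then show ?thesis using C[OF that] by (simp add: C'_def)
  qed
  moreover have "(fscale c m + f) p =
      (\<Sum>t\<le>?a + ?b. C' t p * pair_monomial ?a ?b t (p (Suc n)) (p (Suc (Suc n)))) +
      bracket (p (Suc n)) (p (Suc (Suc n))) * g' p" for p
  proof -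
    have "t0 \<le> ?a + ?b" using le' by (simp add: t0_def)
    then have "(\<Sum>t\<le>?a + ?b. C' t p * pair_monomial ?a ?b t (p (Suc n)) (p (Suc (Suc n)))) =
        c * monomial n D e p * pair_monomial ?a ?b t0 (p (Suc n)) (p (Suc (Suc n))) +
        (\<Sum>t\<le>?a + ?b. C t p * pair_monomial ?a ?b t (p (Suc n)) (p (Suc (Suc n))))"
      by (simp add: C'_def distrib_right sum.distrib if_distrib[of "\<lambda>z. z * _"] cong: if_cong)
    then show ?thesis using m f by (simp add: g'_def fscale_def algebra_simps)
  qed
  ultimately have "bracket_division n D (fscale c m + f) C' g'"
    unfolding bracket_division_def by (intro conjI allI impI) blast+
  then show ?case by blast
qed

text \<open>On the locus where the last two vectors both are \<open>(z, 1)\<close>, the remainder becomes a polynomial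
  in \<open>z\<close> with the coefficients \<open>C\<close>. It vanishes identically, so the remainder is zero.\<close>

lemma bracket_divides:
  assumes f: "f \<in> multihom (Suc (Suc n)) D" and van: "\<And>p. p (Suc (Suc n)) = p (Suc n) \<Longrightarrow> f p = 0"
  obtains g where
    "g \<in> multihom (Suc (Suc n)) (D(Suc n := D (Suc n) - 1, Suc (Suc n) := D (Suc (Suc n)) - 1))"
    "D (Suc n) = 0 \<or> D (Suc (Suc n)) = 0 \<longrightarrow> g = 0"
    "\<And>p. f p = bracket (p (Suc n)) (p (Suc (Suc n))) * g p"
proof -
  let ?a = "D (Suc n)" and ?b = "D (Suc (Suc n))"
  obtain C g where "bracket_division n D f C g"
    using bracket_division_exists[OF f] by blast
  note div = this[unfolded bracket_division_def]
  have C: "C t p = C t q" if "\<forall>i\<in>{1..n}. p i = q i" for t p q using div that by blast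
  have eq: "\<forall>p. f p = (\<Sum>t\<le>?a + ?b. C t p * pair_monomial ?a ?b t (p (Suc n)) (p (Suc (Suc n)))) +
      bracket (p (Suc n)) (p (Suc (Suc n))) * g p" using div by (elim conjE)
  have C0: "C t p = 0" if t: "t \<le> ?a + ?b" for t p
  proof -
    \<comment> \<open>A polynomial in one variable that is zero everywhere has zero coefficients.\<close>
    have "(\<Sum>t\<le>?a + ?b. C t p * z ^ t) = 0" for z
    proof -
      define q where "q = p(Suc n := vector [z, 1] :: complex^2, Suc (Suc n) := vector [z, 1])"
      have pm: "pair_monomial ?a ?b t (q (Suc n)) (q (Suc (Suc n))) = z ^ t" for t
        by (simp add: q_def pair_monomial_def Let_def vector_2 flip: power_add)
      have Cq: "C t q = C t p" for t by (rule C) (auto simp: q_def)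
      have "f q = 0" by (rule van) (simp add: q_def)
      moreover have "bracket (q (Suc n)) (q (Suc (Suc n))) = 0" by (simp add: q_def)
      ultimately show ?thesis using spec[OF eq, of q] unfolding pm Cq by simp
    qed
    then show ?thesis using polyfun_eq_0[of "\<lambda>t. C t p" "?a + ?b"] t by blast
  qed
  have "f p = bracket (p (Suc n)) (p (Suc (Suc n))) * g p" for p
    unfolding spec[OF eq, of p] by (simp add: C0)
  with div show ?thesis by (intro that[of g]) blast+
qed

section \<open>The first fundamental theorem for SL(2)\<close>

lemma merge_precompose:
  assumes "f \<in> multihom (Suc (Suc n)) D"
  shows "(\<lambda>p. f (p(Suc (Suc n) := p (Suc n)))) \<in>
    multihom (Suc n) (D(Suc n := D (Suc n) + D (Suc (Suc n))))"
  using assms unfolding multihom_def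
proof (rule span_precompose)
  fix m assume "m \<in> {monomial (Suc (Suc n)) D e | e. \<forall>i\<in>{1..Suc (Suc n)}. e i \<le> D i}"
  then obtain e where e: "m = monomial (Suc (Suc n)) D e" "\<forall>i\<in>{1..Suc (Suc n)}. e i \<le> D i"
    by blast
  let ?D = "D(Suc n := D (Suc n) + D (Suc (Suc n)))"
  let ?e = "e(Suc n := e (Suc n) + e (Suc (Suc n)))"
  have le: "e (Suc n) \<le> D (Suc n)" "e (Suc (Suc n)) \<le> D (Suc (Suc n))" using e(2) by auto
  have "m (p(Suc (Suc n) := p (Suc n))) = monomial (Suc n) ?D ?e p" for p
  proof -
    have 1: "monomial n D e (p(Suc (Suc n) := p (Suc n))) = monomial n D e p"
      by (auto simp: monomial_def intro!: prod.cong)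
    have 2: "monomial n ?D ?e = monomial n D e" by (rule monomial_cong) auto
    have 3: "D (Suc n) + D (Suc (Suc n)) - (e (Suc n) + e (Suc (Suc n))) =
        (D (Suc n) - e (Suc n)) + (D (Suc (Suc n)) - e (Suc (Suc n)))" using le by simp
    show ?thesis unfolding e(1) monomial_Suc 1 2 by (simp add: 3 power_add)
  qed
  then have "(\<lambda>p. m (p(Suc (Suc n) := p (Suc n)))) = monomial (Suc n) ?D ?e" by blast
  moreover have "monomial (Suc n) ?D ?e \<in> multihom (Suc n) ?D"
    using e(2) by (intro monomial_in_multihom) (auto intro!: add_mono)
  ultimately show "(\<lambda>p. m (p(Suc (Suc n) := p (Suc n)))) \<in>
      cfun.span {monomial (Suc n) ?D e | e. \<forall>i\<in>{1..Suc n}. e i \<le> ?D i}"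
    unfolding multihom_def by simp
qed

lemma bracket_monomial_relabel:
  "bracket_monomial E (\<lambda>v. p (\<mu> v)) = bracket_monomial (image_mset (map_prod \<mu> \<mu>) E) p"
  by (induction E) simp_all

text \<open>A vertex \<open>m\<close> can be split into \<open>m\<close> and a new vertex \<open>N\<close> by redirecting to \<open>N\<close> any prescribed
  number \<open>b\<close> of the ends of edges at \<open>m\<close>. The two ends of a loop at \<open>m\<close> count separately.\<close>

lemma split_vertex:
  assumes "\<And>i j. (i, j) \<in># E \<Longrightarrow> i \<noteq> N \<and> j \<noteq> N" "b \<le> deg E m" "m \<noteq> N"
  shows "\<exists>E'. image_mset (map_prod (id(N := m)) (id(N := m))) E' = E \<and>
     deg E' N = b \<and> deg E' m = deg E m - b \<and> (\<forall>v. v \<noteq> m \<longrightarrow> v \<noteq> N \<longrightarrow> deg E' v = deg E v)"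
  using assms(1,2)
proof (induction E arbitrary: b)
  case empty
  then show ?case by (intro exI[of _ "{#}"]) simp
next
  case (add e E)
  obtain i j where e: "e = (i, j)" by (cases e)
  have ij: "i \<noteq> N" "j \<noteq> N" using add.prems(1) e by auto
  \<comment> \<open>Of the \<open>b\<close> ends, \<open>b1\<close> are redirected in the rest of the graph and \<open>r\<close> at the new edge.\<close>
  define b1 where "b1 = min b (deg E m)"
  define r where "r = b - b1"
  have b1: "b1 \<le> deg E m" "b = b1 + r" by (auto simp: b1_def r_def)
  have r: "r \<le> of_bool (i = m) + of_bool (j = m)"
    using add.prems(2) e by (auto simp: r_def b1_def min_def split: if_splits)
  have r': "r = 0 \<or> b1 = deg E m" by (auto simp: r_def b1_def min_def)
  have prem: "i \<noteq> N \<and> j \<noteq> N" if "(i, j) \<in># E" for i j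
    using add.prems(1)[of i j] that by simp
  have "\<exists>E'. image_mset (map_prod (id(N := m)) (id(N := m))) E' = E \<and>
     deg E' N = b1 \<and> deg E' m = deg E m - b1 \<and> (\<forall>v. v \<noteq> m \<longrightarrow> v \<noteq> N \<longrightarrow> deg E' v = deg E v)"
    by (rule add.IH, erule prem, rule b1(1))
  then obtain E1 where E1: "image_mset (map_prod (id(N := m)) (id(N := m))) E1 = E"
     "deg E1 N = b1" "deg E1 m = deg E m - b1" "\<forall>v. v \<noteq> m \<longrightarrow> v \<noteq> N \<longrightarrow> deg E1 v = deg E v"
    by blast
  define i' where "i' = (if i = m \<and> r \<ge> 1 then N else i)"
  define j' where "j' = (if j = m \<and> r \<ge> (if i = m then 2 else 1) then N else j)"
  have r3: "r = 0 \<or> r = 1 \<or> r = 2" using r by (auto simp: of_bool_def split: if_splits)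
  have "image_mset (map_prod (id(N := m)) (id(N := m))) (add_mset (i', j') E1) = add_mset e E"
    using E1(1) ij by (auto simp: e i'_def j'_def)
  moreover have "deg (add_mset (i', j') E1) N = b"
  proof -
    have "of_bool (i' = N) + of_bool (j' = N) = r"
      using r3 r ij assms(3) unfolding i'_def j'_def
      by (elim disjE) (auto simp: of_bool_def split: if_splits)
    then show ?thesis using E1(2) b1(2) by simp
  qed
  moreover have "deg (add_mset (i', j') E1) m = deg (add_mset e E) m - b"
  proof -
    have "of_bool (i' = m) + of_bool (j' = m) + r = (of_bool (i = m) + of_bool (j = m) :: nat)"
      using r3 r ij assms(3) unfolding i'_def j'_def
      by (elim disjE) (auto simp: of_bool_def split: if_splits)
    then show ?thesis using E1(3) b1 by (simp add: e)
  qed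
  moreover have "deg (add_mset (i', j') E1) v = deg (add_mset e E) v" if "v \<noteq> m" "v \<noteq> N" for v
    using E1(4) that by (simp add: e i'_def j'_def)
  ultimately show ?case by blast
qed

text \<open>Restriction to the locus where the last two vectors agree is surjective on combinations
  of products of brackets: splitting the merged vertex gives preimages.\<close>

lemma lift_bracket_span:
  assumes "f \<in> bracket_span (Suc n) (D(Suc n := D (Suc n) + D (Suc (Suc n))))"
  shows "\<exists>h\<in>bracket_span (Suc (Suc n)) D. \<forall>p. h (p(Suc (Suc n) := p (Suc n))) = f p"
  using assms unfolding bracket_span_def[of "Suc n"]
proof (induction rule: cfun.span_induct_alt)
  case base
  have "0 \<in> bracket_span (Suc (Suc n)) D" by (simp only: bracket_span_def cfun.span_zero)
  then show ?case by (intro bexI[of _ 0]) auto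
next
  case (step c m f)
  let ?D = "D(Suc n := D (Suc n) + D (Suc (Suc n)))"
  let ?N = "Suc (Suc n)"
  obtain E where E: "m = bracket_monomial E" "set_mset E \<subseteq> {1..Suc n} \<times> {1..Suc n}"
    "\<forall>v\<in>{1..Suc n}. deg E v = ?D v" using step by blast
  obtain h where h: "h \<in> bracket_span (Suc (Suc n)) D" "\<forall>p. h (p(?N := p (Suc n))) = f p"
    using step by blast
  have deg: "deg E (Suc n) = D (Suc n) + D ?N" using E(3) by auto
  have "\<exists>E'. image_mset (map_prod (id(?N := Suc n)) (id(?N := Suc n))) E' = E \<and>
     deg E' ?N = D ?N \<and> deg E' (Suc n) = deg E (Suc n) - D ?N \<and>
     (\<forall>v. v \<noteq> Suc n \<longrightarrow> v \<noteq> ?N \<longrightarrow> deg E' v = deg E v)"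
    by (rule split_vertex) (use E(2) deg in auto)
  then obtain E' where E': "image_mset (map_prod (id(?N := Suc n)) (id(?N := Suc n))) E' = E"
     "deg E' ?N = D ?N" "deg E' (Suc n) = D (Suc n)"
     "\<And>v. v \<noteq> Suc n \<Longrightarrow> v \<noteq> ?N \<Longrightarrow> deg E' v = deg E v" using deg by auto
  have "set_mset E' \<subseteq> {1..?N} \<times> {1..?N}"
  proof
    fix x assume "x \<in> set_mset E'"
    then have "map_prod (id(?N := Suc n)) (id(?N := Suc n)) x \<in> set_mset E"
      unfolding E'(1)[symmetric] by simp
    then show "x \<in> {1..?N} \<times> {1..?N}" using E(2) by (cases x) (auto split: if_splits)
  qed
  moreover have "deg E' v = D v" if "v \<in> {1..?N}" for v
    using that E'(2-4) E(3) by (cases "v = ?N"; cases "v = Suc n") auto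
  ultimately have "bracket_monomial E' \<in> bracket_span ?N D"
    by (rule bracket_monomial_in_span)
  then have "fscale c (bracket_monomial E') + h \<in> bracket_span ?N D"
    using h(1) unfolding bracket_span_def by (intro cfun.span_add cfun.span_scale)
  moreover have "(fscale c (bracket_monomial E') + h) (p(?N := p (Suc n))) = (fscale c m + f) p" for p
  proof -
    have "p(?N := p (Suc n)) = (\<lambda>v. p ((id(?N := Suc n)) v))" by auto
    then have "bracket_monomial E' (p(?N := p (Suc n))) = m p"
      using bracket_monomial_relabel[of E' p "id(?N := Suc n)"] E'(1) E(1) by simp
    then show ?thesis using h(2) by (simp add: fscale_def)
  qed
  ultimately show ?case by blast
qed

text \<open>The bracket is nonzero at points arbitrarily close to any given point, and the other factor
  is continuous.\<close>

lemma cancel_bracket: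
  assumes g: "g \<in> multihom n D" and "a \<noteq> b"
    and eq: "\<And>p. bracket (p a) (p b) * (g (\<lambda>i. A *v p i) - c * g p) = 0"
  shows "g (\<lambda>i. A *v p i) = c * g p"
proof -
  \<comment> \<open>A curve through \<open>p\<close> along which the bracket is a monic quadratic polynomial in \<open>t\<close>.\<close>
  define \<gamma> where "\<gamma> t = p(a := p a + vector [t, 0], b := p b + vector [0, t] :: complex^2)" for t :: complex
  have ab: "bracket (\<gamma> t a) (\<gamma> t b) = bracket (p a) (p b) + t * (p a $ 1 + p b $ 2) + t ^ 2" for t
    using assms(2) by (simp add: \<gamma>_def bracket_def vector_2 algebra_simps power2_eq_square)
  have "eventually (\<lambda>t. bracket (\<gamma> t a) (\<gamma> t b) \<noteq> 0) (at 0)"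
  proof -
    have "finite {t. bracket (\<gamma> t a) (\<gamma> t b) = 0}"
    proof -
      have "bracket (\<gamma> t a) (\<gamma> t b) =
          poly [:bracket (p a) (p b), p a $ 1 + p b $ 2, 1:] t" for t
        unfolding ab by (simp add: algebra_simps power2_eq_square)
      then show ?thesis by (simp only: poly_roots_finite pCons_eq_0_iff one_neq_zero simp_thms)
    qed
    then have "finite ({t. bracket (\<gamma> t a) (\<gamma> t b) = 0} - {0})" by blast
    then have "closed ({t. bracket (\<gamma> t a) (\<gamma> t b) = 0} - {0})" by (rule finite_imp_closed)
    then have "open (- ({t. bracket (\<gamma> t a) (\<gamma> t b) = 0} - {0}))" by (rule open_Compl)
    then show ?thesis
      unfolding eventually_at_topological
      by (intro exI[of _ "- ({t. bracket (\<gamma> t a) (\<gamma> t b) = 0} - {0})"]) auto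
  qed
  then have ev: "eventually (\<lambda>t. g (\<lambda>i. A *v \<gamma> t i) - c * g (\<gamma> t) = 0) (at 0)"
    by (rule eventually_mono) (use eq in \<open>metis mult_eq_0_iff\<close>)
  have lim_vec: "((\<lambda>t. w + vector [t, 0]) \<longlongrightarrow> w) (at 0)" "((\<lambda>t. w + vector [0, t]) \<longlongrightarrow> w) (at 0)"
    for w :: "complex^2"
  proof -
    show "((\<lambda>t. w + vector [t, 0]) \<longlongrightarrow> w) (at 0)"
    proof (rule vec_tendstoI)
      fix i :: 2 show "((\<lambda>t. (w + vector [t, 0]) $ i) \<longlongrightarrow> w $ i) (at 0)"
        using exhaust_2[of i] by (elim disjE; simp; auto intro!: tendsto_eq_intros)
    qed
    show "((\<lambda>t. w + vector [0, t]) \<longlongrightarrow> w) (at 0)"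
    proof (rule vec_tendstoI)
      fix i :: 2 show "((\<lambda>t. (w + vector [0, t]) $ i) \<longlongrightarrow> w $ i) (at 0)"
        using exhaust_2[of i] by (elim disjE; simp; auto intro!: tendsto_eq_intros)
    qed
  qed
  have lim: "((\<lambda>t. \<gamma> t i) \<longlongrightarrow> p i) (at 0)" for i
    unfolding \<gamma>_def using lim_vec by (cases "i = b"; cases "i = a") simp_all
  have limA: "((\<lambda>t. A *v \<gamma> t i) \<longlongrightarrow> A *v p i) (at 0)" for i
    using lim by (intro vec_tendstoI) (auto simp: matrix_vector_mult_def intro!: tendsto_intros)
  have lim1: "((\<lambda>t. g (\<lambda>i. A *v \<gamma> t i) - c * g (\<gamma> t)) \<longlongrightarrow> g (\<lambda>i. A *v p i) - c * g p) (at 0)"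
    by (intro tendsto_intros multihom_tendsto[OF g] lim limA)
  have lim2: "((\<lambda>t. g (\<lambda>i. A *v \<gamma> t i) - c * g (\<gamma> t)) \<longlongrightarrow> 0) (at 0)"
    by (rule tendsto_eventually[OF ev])
  have "g (\<lambda>i. A *v p i) - c * g p = 0"
    by (rule tendsto_unique[OF at_neq_bot lim1 lim2])
  then show ?thesis by simp
qed

lemma bracket_span_degree_zero:
  assumes "f \<in> multihom n D" "\<And>i. i \<in> {1..n} \<Longrightarrow> D i = 0"
  shows "f \<in> bracket_span n D"
proof -
  have "monomial n D e = bracket_monomial {#}" if "\<forall>i\<in>{1..n}. e i \<le> D i" for e
    using that assms(2) by (intro ext) (simp add: monomial_def)
  moreover have "bracket_monomial {#} \<in> bracket_span n D"
    by (rule bracket_monomial_in_span) (use assms(2) in auto)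
  ultimately have "{monomial n D e | e. \<forall>i\<in>{1..n}. e i \<le> D i} \<subseteq> bracket_span n D"
    by auto
  then have "multihom n D \<subseteq> bracket_span n D"
    unfolding multihom_def by (rule cfun.span_minimal) (simp add: bracket_span_def)
  with assms(1) show ?thesis by blast
qed

text \<open>The matrix \<open>diag(1, 2)\<close> fixes the vectors \<open>(x, 0)\<close> but has determinant \<open>2\<close>, so \<open>f\<close>
  vanishes at them; all other vectors are images of \<open>(1, 0)\<close> under invertible matrices.\<close>

lemma single_vector_semi_invariant:
  assumes f: "f \<in> multihom (Suc 0) D" and "w > 0"
    and inv: "\<And>A p. invertible A \<Longrightarrow> f (\<lambda>i. A *v p i) = det A ^ w * f p"
  shows "f = 0"
proof
  fix p
  have inv': "invertible A" if "det A \<noteq> 0" for A :: "complex^2^2"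
    using that invertible_det_nz by blast
  have loc: "f p = f q" if "p 1 = q 1" for p q
    by (rule multihom_local[OF f]) (use that in auto)
  have 0: "f (\<lambda>_. vector [x, 0]) = 0" for x
  proof -
    define A :: "complex^2^2" where "A = vector [vector [1, 0], vector [0, 2]]"
    have det: "det A = 2" by (simp add: A_def det_2)
    have "A *v vector [x, 0] = vector [x, 0]"
      by (simp add: A_def vec_eq_iff forall_2 matrix_vector_mult_def sum_2)
    then have "f (\<lambda>_. vector [x, 0]) = 2 ^ w * f (\<lambda>_. vector [x, 0])"
      using inv[of A "\<lambda>_. vector [x, 0]"] inv'[of A] det by simp
    moreover have "(2::complex) ^ w \<noteq> 1"
      using assms(2) by (metis norm_numeral norm_one norm_power one_less_numeral_iff
          one_less_power order_less_irrefl semiring_norm(76))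
    ultimately show ?thesis by simp
  qed
  show "f p = 0 p"
  proof (cases "p 1 $ 2 = 0")
    case True
    then have "p 1 = vector [p 1 $ 1, 0]" by (simp add: vec_eq_iff forall_2)
    then have "f p = f (\<lambda>_. vector [p 1 $ 1, 0])" by (rule loc)
    then show ?thesis using 0 by simp
  next
    case False
    define A :: "complex^2^2" where "A = vector [vector [p 1 $ 1, 1], vector [p 1 $ 2, 0]]"
    have det: "det A \<noteq> 0" using False by (simp add: A_def det_2)
    have "A *v vector [1, 0] = p 1"
      by (simp add: A_def vec_eq_iff forall_2 matrix_vector_mult_def sum_2)
    then have "f p = f (\<lambda>_. A *v vector [1, 0])" by (intro loc) simp
    also have "\<dots> = det A ^ w * f (\<lambda>_. vector [1, 0])" using inv[OF inv'[OF det]] .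
    finally show ?thesis using 0 by simp
  qed
qed

text \<open>The first fundamental theorem for the special linear group of rank two, for semi-invariants of
  \<open>GL(2)\<close>. The outer induction is on the number of vectors, the inner one on the weight \<open>w\<close>: the
  restriction \<open>f'\<close> to the locus where the last two vectors agree involves fewer vectors, and after
  subtracting a lift \<open>h\<close> of \<open>f'\<close> the quotient by the bracket has smaller weight.\<close>

theorem semi_invariant_in_bracket_span:
  assumes "f \<in> multihom n D" "(\<Sum>i=1..n. D i) = 2 * w"
    and "\<And>A p. invertible A \<Longrightarrow> f (\<lambda>i. A *v p i) = det A ^ w * f p"
  shows "f \<in> bracket_span n D"
  using assms
proof (induction n arbitrary: f D w)
  case 0
  then show ?case by (intro bracket_span_degree_zero) auto
next
  case (Suc n0)
  show ?case
  proof (cases n0)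
    case 0
    show ?thesis
    proof (cases "w = 0")
      case True
      then show ?thesis using Suc.prems 0 by (intro bracket_span_degree_zero) auto
    next
      case False
      then have "f = 0" using Suc.prems 0 single_vector_semi_invariant[of f D w] by simp
      then show ?thesis by (simp only: bracket_span_def cfun.span_zero)
    qed
  next
    case n0: (Suc n)
    let ?N = "Suc (Suc n)"
    have "f \<in> bracket_span ?N D" if "f \<in> multihom ?N D" "(\<Sum>i=1..?N. D i) = 2 * w"
      "\<And>A p. invertible A \<Longrightarrow> f (\<lambda>i. A *v p i) = det A ^ w * f p" for f D w
      using that
    proof (induction w arbitrary: f D rule: less_induct)
      case (less w)
      let ?D = "D(Suc n := D (Suc n) + D ?N)"
      let ?D' = "D(Suc n := D (Suc n) - 1, ?N := D ?N - 1)"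
      define f' where "f' p = f (p(?N := p (Suc n)))" for p
      have "f' \<in> multihom (Suc n) ?D"
        unfolding f'_def using merge_precompose[OF less.prems(1)] .
      moreover have "(\<Sum>i=1..Suc n. ?D i) = 2 * w"
      proof -
        have "(\<Sum>i=1..n. ?D i) = (\<Sum>i=1..n. D i)" by (intro sum.cong) auto
        then show ?thesis using less.prems(2) by simp
      qed
      moreover have "f' (\<lambda>i. A *v p i) = det A ^ w * f' p" if "invertible A" for A p
      proof -
        have eq: "(\<lambda>i. A *v p i)(?N := A *v p (Suc n)) = (\<lambda>i. A *v (p(?N := p (Suc n))) i)"
          by auto
        show ?thesis unfolding f'_def eq by (rule less.prems(3)[OF that])
      qed
      ultimately have "f' \<in> bracket_span (Suc n) ?D"
        using Suc.IH[unfolded n0] by blast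
      from lift_bracket_span[OF this] obtain h where h: "h \<in> bracket_span ?N D"
        "\<forall>p. h (p(?N := p (Suc n))) = f' p" by blast
      define r where "r = f + fscale (-1) h"
      have r: "r \<in> multihom ?N D"
        using less.prems(1) h(1) bracket_span_multihom[of ?N D] unfolding r_def multihom_def
        by (intro cfun.span_add cfun.span_scale) auto
      have r_inv: "r (\<lambda>i. A *v p i) = det A ^ w * r p" if "invertible A" for A p
        using less.prems(3)[OF that] bracket_span_semi_invariant[OF h(1) less.prems(2)]
        by (simp add: r_def fscale_def algebra_simps)
      have "r p = 0" if "p ?N = p (Suc n)" for p
      proof -
        have "p(?N := p (Suc n)) = p" using that by auto
        then show ?thesis using h(2) by (simp add: r_def fscale_def f'_def) (metis)
      qed
      from bracket_divides[OF r this] obtain g where g: "g \<in> multihom ?N ?D'"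
        "D (Suc n) = 0 \<or> D ?N = 0 \<longrightarrow> g = 0" "\<And>p. r p = bracket (p (Suc n)) (p ?N) * g p" by blast
      have "r \<in> bracket_span ?N D"
      proof (cases "D (Suc n) = 0 \<or> D ?N = 0")
        case True
        then have "r = 0" using g(2,3) by (intro ext) simp
        then show ?thesis by (simp only: bracket_span_def cfun.span_zero)
      next
        case False
        then have D: "D (Suc n) > 0" "D ?N > 0" by auto
        then obtain w' where w: "w = Suc w'" using less.prems(2) by (cases w) auto
        have sum: "(\<Sum>i=1..?N. ?D' i) = 2 * w'"
        proof -
          have "(\<Sum>i=1..n. ?D' i) = (\<Sum>i=1..n. D i)" by (intro sum.cong) auto
          then show ?thesis using less.prems(2) D w by simp
        qed
        have "g (\<lambda>i. A *v p i) = det A ^ w' * g p" if "invertible A" for A p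
        proof (rule cancel_bracket[OF g(1), of "Suc n" ?N])
          fix p
          have "det A \<noteq> 0" using that invertible_det_nz by blast
          then show "bracket (p (Suc n)) (p ?N) * (g (\<lambda>i. A *v p i) - det A ^ w' * g p) = 0"
            using r_inv[OF that, of p] unfolding g(3) bracket_linear w
            by (simp add: algebra_simps)
        qed simp
        then have "g \<in> bracket_span ?N ?D'"
          using less.IH[of w' g ?D'] g(1) sum w by blast
        then have "(\<lambda>p. bracket (p (Suc n)) (p ?N)) * g \<in> bracket_span ?N D"
          unfolding bracket_span_def
        proof (rule span_mult_closed[OF cfun.span_base, rotated])
          show "(\<lambda>p. bracket (p (Suc n)) (p ?N)) \<in> {\<lambda>p. bracket (p (Suc n)) (p ?N)}" by simp
          fix x y assume x: "x \<in> {\<lambda>p. bracket (p (Suc n)) (p ?N)}" and "y \<in> {bracket_monomial E | E.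
             set_mset E \<subseteq> {1..?N} \<times> {1..?N} \<and> (\<forall>v\<in>{1..?N}. deg E v = ?D' v)}"
          then obtain E where E: "y = bracket_monomial E" "set_mset E \<subseteq> {1..?N} \<times> {1..?N}"
            "\<forall>v\<in>{1..?N}. deg E v = ?D' v" by blast
          have "x * y = bracket_monomial (add_mset (Suc n, ?N) E)"
            using x E(1) by (intro ext) simp
          moreover have "\<dots> \<in> bracket_span ?N D"
            by (rule bracket_monomial_in_span) (use E D in auto)
          ultimately show "x * y \<in> cfun.span {bracket_monomial E | E.
             set_mset E \<subseteq> {1..?N} \<times> {1..?N} \<and> (\<forall>v\<in>{1..?N}. deg E v = D v)}"
            unfolding bracket_span_def by simp
        qed
        moreover have "r = (\<lambda>p. bracket (p (Suc n)) (p ?N)) * g"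
          using g(3) by (intro ext) simp
        ultimately show ?thesis by simp
      qed
      moreover have "f = r + h" by (auto simp: r_def fscale_def)
      ultimately show ?case using h(1) unfolding bracket_span_def
        by (simp only: cfun.span_add)
    qed
    then show ?thesis using Suc.prems unfolding n0 by blast
  qed
qed

section \<open>Regular multigraphs and Kempe's theorem\<close>

text \<open>The argument of Halmos and Vaughan: if a nonempty proper subset of \<open>A\<close> has exactly as many
  neighbours as elements, match this subset and its complement separately; otherwise any
  element can be matched with any of its neighbours without violating the condition.\<close>

lemma hall_marriage:
  fixes N :: "'a \<Rightarrow> 'b set"
  assumes "finite A" "\<And>i. i \<in> A \<Longrightarrow> finite (N i)"
    and "\<And>S. S \<subseteq> A \<Longrightarrow> card S \<le> card (\<Union>i\<in>S. N i)"
  shows "\<exists>f. inj_on f A \<and> (\<forall>i\<in>A. f i \<in> N i)"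
  using assms
proof (induction "card A" arbitrary: A N rule: less_induct)
  case less
  note fin = less.prems(1) and finN = less.prems(2) and hall = less.prems(3)
  show ?case
  proof (cases "\<exists>S. S \<subset> A \<and> S \<noteq> {} \<and> card (\<Union>i\<in>S. N i) = card S")
    case True
    then obtain S where S: "S \<subset> A" "S \<noteq> {}" "card (\<Union>i\<in>S. N i) = card S" by blast
    let ?M = "\<Union>i\<in>S. N i"
    have finS: "finite S" using S(1) fin by (meson finite_subset psubset_imp_subset)
    have finM: "finite ?M" using finS finN S(1) by (intro finite_UN_I) auto
    have "card S < card A" using S(1) fin by (rule psubset_card_mono[rotated])
    then have "\<exists>f. inj_on f S \<and> (\<forall>i\<in>S. f i \<in> N i)"
    proof (rule less.hyps[OF _ finS])
      show "finite (N i)" if "i \<in> S" for i using that S(1) finN by blast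
      show "card U \<le> card (\<Union>i\<in>U. N i)" if "U \<subseteq> S" for U using that S(1) hall[of U] by blast
    qed
    then obtain f where f: "inj_on f S" "\<forall>i\<in>S. f i \<in> N i" by blast
    have "card (A - S) < card A" using S(1,2) by (intro psubset_card_mono[OF fin]) blast
    then have "\<exists>g. inj_on g (A - S) \<and> (\<forall>i\<in>A - S. g i \<in> N i - ?M)"
    proof (rule less.hyps)
      show "finite (A - S)" using fin by blast
      show "finite (N i - ?M)" if "i \<in> A - S" for i using that finN by blast
      show "card U \<le> card (\<Union>i\<in>U. N i - ?M)" if U: "U \<subseteq> A - S" for U
      proof -
        have finU: "finite U" using U fin by (meson Diff_subset finite_subset order_trans)
        have finNU: "finite (\<Union>i\<in>U. N i)" using finU finN U by (intro finite_UN_I) auto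
        have "card U + card S = card (U \<union> S)"
          using U finU finS by (intro card_Un_disjoint[symmetric]) auto
        also have "\<dots> \<le> card (\<Union>i\<in>U \<union> S. N i)" using hall[of "U \<union> S"] U S(1) by blast
        also have "(\<Union>i\<in>U \<union> S. N i) = (\<Union>i\<in>U. N i - ?M) \<union> ?M" by auto
        also have "card \<dots> = card (\<Union>i\<in>U. N i - ?M) + card ?M"
        proof (rule card_Un_disjoint)
          show "finite (\<Union>i\<in>U. N i - ?M)" by (rule finite_subset[OF _ finNU]) auto
        qed (use finM in auto)
        finally show ?thesis using S(3) by simp
      qed
    qed
    then obtain g where g: "inj_on g (A - S)" "\<forall>i\<in>A - S. g i \<in> N i - ?M" by blast
    define h where "h i = (if i \<in> S then f i else g i)" for i
    have "inj_on h A"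
    proof -
      have 1: "f i \<in> ?M" if "i \<in> S" for i using f(2) that by blast
      have 2: "g i \<notin> ?M" if "i \<in> A - S" for i using g(2) that by (metis DiffD2)
      have "f ` S \<inter> g ` (A - S) = {}"
      proof (rule equals0I)
        fix z assume z: "z \<in> f ` S \<inter> g ` (A - S)"
        then have "z \<in> ?M" using 1 by (metis IntD1 imageE)
        moreover have "z \<notin> ?M" using 2 z by (metis IntD2 imageE)
        ultimately show False by contradiction
      qed
      then have "inj_on h (S \<union> (A - S))"
        unfolding h_def by (rule inj_on_disjoint_Un[OF f(1) g(1)])
      moreover have "S \<union> (A - S) = A" using S(1) by blast
      ultimately show ?thesis by simp
    qed
    moreover have "\<forall>i\<in>A. h i \<in> N i" using f g by (auto simp: h_def)
    ultimately show ?thesis by blast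
  next
    case False
    show ?thesis
    proof (cases "A = {}")
      case False
      then obtain a where a: "a \<in> A" by blast
      have "card {a} \<le> card (N a)" using hall[of "{a}"] a by simp
      then have "N a \<noteq> {}" by auto
      then obtain x where x: "x \<in> N a" by blast
      have "card (A - {a}) < card A" using a fin by (rule card_Diff1_less[rotated])
      then have "\<exists>f. inj_on f (A - {a}) \<and> (\<forall>i\<in>A - {a}. f i \<in> N i - {x})"
      proof (rule less.hyps)
        show "finite (A - {a})" using fin by blast
        show "finite (N i - {x})" if "i \<in> A - {a}" for i using that finN by blast
        show "card U \<le> card (\<Union>i\<in>U. N i - {x})" if U: "U \<subseteq> A - {a}" for U
        proof (cases "U = {}")
          case False
          have "U \<subset> A" using U a by blast
          then have "card U \<noteq> card (\<Union>i\<in>U. N i)"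
            using False \<open>\<not> (\<exists>S. S \<subset> A \<and> S \<noteq> {} \<and> card (\<Union>i\<in>S. N i) = card S)\<close> by metis
          moreover have "card U \<le> card (\<Union>i\<in>U. N i)" using hall \<open>U \<subset> A\<close> by blast
          ultimately have "card U \<le> card (\<Union>i\<in>U. N i) - 1" by simp
          also have "\<dots> \<le> card ((\<Union>i\<in>U. N i) - {x})" by (simp add: card_Diff_singleton_if)
          also have "(\<Union>i\<in>U. N i) - {x} = (\<Union>i\<in>U. N i - {x})" by blast
          finally show ?thesis .
        qed simp
      qed
      then obtain f where f: "inj_on f (A - {a})" "\<forall>i\<in>A - {a}. f i \<in> N i - {x}" by blast
      have "inj_on (f(a := x)) A"
        using f by (auto simp: inj_on_def)
      moreover have "\<forall>i\<in>A. (f(a := x)) i \<in> N i" using f x by auto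
      ultimately show ?thesis by blast
    qed simp
  qed
qed

lemma sum_deg_filter:
  assumes "finite S"
  shows "(\<Sum>v\<in>S. deg E v) = size (filter_mset (\<lambda>e. fst e \<in> S) E) + size (filter_mset (\<lambda>e. snd e \<in> S) E)"
proof (induction E)
  case (add e E)
  have "(\<Sum>v\<in>S. of_bool (x = v)) = (if x \<in> S then 1 else 0 :: nat)" for x
    using assms by (simp add: of_bool_def)
  then show ?case using add by (simp add: sum.distrib)
qed simp

text \<open>Hall's condition follows by double counting: all edges that start in a subset \<open>S\<close> of \<open>A\<close>
  end in the neighbourhood of \<open>S\<close>, and every vertex is on \<open>d\<close> edges.\<close>

lemma regular_bipartite_matching:
  assumes E: "set_mset E \<subseteq> A \<times> B" "A \<inter> B = {}" "finite A" "finite B" "card A = card B"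
    and deg: "\<And>v. v \<in> A \<union> B \<Longrightarrow> deg E v = d" "d > 0"
  obtains \<pi> where "bij_betw \<pi> A B" "\<And>i. i \<in> A \<Longrightarrow> (i, \<pi> i) \<in># E"
proof -
  define N where "N i = {j. (i, j) \<in># E}" for i
  have NB: "N i \<subseteq> B" for i using E(1) by (auto simp: N_def)
  have "\<exists>\<pi>. inj_on \<pi> A \<and> (\<forall>i\<in>A. \<pi> i \<in> N i)"
  proof (rule hall_marriage)
    show "finite (N i)" for i using NB E(4) by (rule finite_subset)
    show "card S \<le> card (\<Union>i\<in>S. N i)" if S: "S \<subseteq> A" for S
    proof -
      let ?M = "\<Union>i\<in>S. N i"
      have fin: "finite S" "finite ?M"
        using S E(3,4) NB by (auto intro: finite_subset)
      have MB: "?M \<subseteq> B" using NB by blast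
      have AB: "fst e \<in> A \<and> snd e \<in> B" if "e \<in># E" for e using that E(1) by auto
      have "filter_mset (\<lambda>e. snd e \<in> S) E = {#}" "filter_mset (\<lambda>e. fst e \<in> ?M) E = {#}"
        unfolding filter_mset_eq_mempty_iff using AB S MB E(2) by blast+
      then have eq: "(\<Sum>v\<in>S. deg E v) = size (filter_mset (\<lambda>e. fst e \<in> S) E)"
          "(\<Sum>v\<in>?M. deg E v) = size (filter_mset (\<lambda>e. snd e \<in> ?M) E)"
        using sum_deg_filter[OF fin(1), of E] sum_deg_filter[OF fin(2), of E] by simp_all
      have "filter_mset (\<lambda>e. fst e \<in> S) E \<subseteq># filter_mset (\<lambda>e. snd e \<in> ?M) E"
      proof (rule mset_subset_eqI)
        fix x show "count (filter_mset (\<lambda>e. fst e \<in> S) E) x \<le> count (filter_mset (\<lambda>e. snd e \<in> ?M) E) x"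
          by (cases x) (auto simp: N_def not_in_iff)
      qed
      then have "(\<Sum>v\<in>S. deg E v) \<le> (\<Sum>v\<in>?M. deg E v)"
        unfolding eq by (rule size_mset_mono)
      moreover have "(\<Sum>v\<in>S. deg E v) = d * card S" using deg(1) S by (subst sum.cong[OF refl, of S _ "\<lambda>_. d"]) auto
      moreover have "(\<Sum>v\<in>?M. deg E v) = d * card ?M" using deg(1) MB by (subst sum.cong[OF refl, of ?M _ "\<lambda>_. d"]) auto
      ultimately show ?thesis using deg(2) by simp
    qed
  qed fact
  then obtain \<pi> where \<pi>: "inj_on \<pi> A" "\<forall>i\<in>A. \<pi> i \<in> N i" by blast
  have "\<pi> ` A = B"
    using \<pi> NB E(3-5) by (intro card_seteq) (auto simp: card_image)
  with \<pi> show ?thesis by (intro that[of \<pi>]) (auto simp: bij_betw_def N_def)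
qed

text \<open>The columns of a tableau form a perfect matching.\<close>

definition tableau_edges :: "nat \<Rightarrow> (nat \<times> nat \<Rightarrow> nat) \<Rightarrow> (nat \<times> nat) multiset" where
  "tableau_edges k T = image_mset (\<lambda>j. (T (1, j), T (2, j))) (mset_set {1..k})"

lemma tableau_edges_range:
  assumes "is_tableau k T"
  shows "set_mset (tableau_edges k T) \<subseteq> {1..2*k} \<times> {1..2*k}"
proof -
  have "T ` ({1..2} \<times> {1..k}) = {1..2*k}" using assms by (simp add: is_tableau_def bij_betw_def)
  moreover have "(1::nat, j) \<in> {1..2} \<times> {1..k}" "(2::nat, j) \<in> {1..2} \<times> {1..k}" if "j \<in> {1..k}" for j :: nat
    using that by auto
  ultimately have "T (1, j) \<in> {1..2*k} \<and> T (2, j) \<in> {1..2*k}" if "j \<in> {1..k}" for j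
    using that by blast
  then show ?thesis by (auto simp: tableau_edges_def)
qed

lemma tableau_deg:
  assumes T: "is_tableau k T" and v: "v \<in> {1..2*k}"
  shows "deg (tableau_edges k T) v = 1"
proof -
  have rows: "{1..2::nat} = {1, 2}" by auto
  have bij: "inj_on T ({1..2} \<times> {1..k})" "T ` ({1..2} \<times> {1..k}) = {1..2*k}"
    using T by (auto simp: is_tableau_def bij_betw_def)
  have split: "{1..2} \<times> {1..k} = Pair (1::nat) ` {1..k} \<union> Pair 2 ` {1..k}"
    unfolding rows by auto
  have "mset_set {1..2*k} = image_mset T (mset_set ({1..2} \<times> {1..k}))"
    using bij by (simp add: image_mset_mset_set)
  also have "mset_set ({1..2} \<times> {1..k}) = mset_set (Pair (1::nat) ` {1..k}) + mset_set (Pair 2 ` {1..k})"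
    unfolding split by (rule mset_set_Union) auto
  also have "\<dots> = image_mset (Pair 1) (mset_set {1..k}) + image_mset (Pair 2) (mset_set {1..k})"
    by (simp add: image_mset_mset_set inj_on_def)
  finally have eq: "mset_set {1..2*k} =
      image_mset fst (tableau_edges k T) + image_mset snd (tableau_edges k T)"
    by (simp add: tableau_edges_def multiset.map_comp comp_def)
  show ?thesis unfolding deg_def eq[symmetric] using v by simp
qed

lemma is_tableau_matching:
  assumes "bij_betw \<pi> {1..k} {k+1..2*k}"
  shows "is_tableau k (\<lambda>(r, j). if r = 1 then j else \<pi> j)" (is "is_tableau k ?T")
proof -
  have rows: "{1..2::nat} = {1, 2}" by auto
  have im: "\<pi> ` {1..k} = {k+1..2*k}" and inj: "inj_on \<pi> {1..k}"
    using assms by (auto simp: bij_betw_def)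
  have \<pi>: "\<pi> j \<in> {k+1..2*k}" if "j \<in> {1..k}" for j using im that by blast
  have neq: "\<pi> j \<noteq> i" if "j \<in> {1..k}" "i \<in> {1..k}" for i j using \<pi>[OF that(1)] that(2) by auto
  have "inj_on ?T ({1, 2} \<times> {1..k})"
  proof (rule inj_onI)
    fix x y assume xy: "x \<in> {1, 2} \<times> {1..k}" "y \<in> {1, 2} \<times> {1..k}" "?T x = ?T y"
    obtain r i r' i' where "x = (r, i)" "y = (r', i')" by (cases x, cases y)
    then show "x = y"
      using xy inj_onD[OF inj, of i i'] neq[of i i'] neq[of i' i] by (auto split: if_splits)
  qed
  moreover have "?T ` ({1, 2} \<times> {1..k}) = {1..k} \<union> \<pi> ` {1..k}"
    by (force simp: image_iff)
  moreover have "{1..k} \<union> {k+1..2*k} = {1..2*k}" by auto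
  ultimately show ?thesis unfolding is_tableau_def bij_betw_def rows im by simp
qed

text \<open>Removing a perfect matching leaves a bipartite graph which is regular of degree \<open>d - 1\<close>.\<close>

lemma regular_bipartite_tableaux:
  assumes "set_mset E \<subseteq> {1..k} \<times> {k+1..2*k}" "\<And>v. v \<in> {1..2*k} \<Longrightarrow> deg E v = d"
  shows "\<exists>T. (\<forall>j<d. is_tableau k (T j)) \<and>
    (\<forall>p. bracket_monomial E p = (\<Prod>j<d. bracket_monomial (tableau_edges k (T j)) p))"
  using assms
proof (induction d arbitrary: E)
  case 0
  have "2 * size E = (\<Sum>v=1..2*k. deg E v)"
    by (rule sum_deg[symmetric]) (use 0(1) in auto)
  then have "E = {#}" using 0(2) by simp
  then show ?case by simp
next
  case (Suc d)
  have "{1..k} \<union> {k+1..2*k} = {1..2*k}" by auto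
  then have deg: "deg E v = Suc d" if "v \<in> {1..k} \<union> {k+1..2*k}" for v using Suc.prems(2) that by blast
  obtain \<pi> where \<pi>: "bij_betw \<pi> {1..k} {k+1..2*k}" "\<And>i. i \<in> {1..k} \<Longrightarrow> (i, \<pi> i) \<in># E"
    using regular_bipartite_matching[OF Suc.prems(1) _ _ _ _ deg] by auto
  define T0 where "T0 = (\<lambda>(r, j). if r = (1::nat) then j else \<pi> j)"
  have T0: "is_tableau k T0" unfolding T0_def by (rule is_tableau_matching[OF \<pi>(1)])
  have edges: "tableau_edges k T0 = mset_set ((\<lambda>j. (j, \<pi> j)) ` {1..k})"
    unfolding tableau_edges_def T0_def by (simp add: image_mset_mset_set inj_on_def)
  have "tableau_edges k T0 \<subseteq># mset_set (set_mset E)"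
    unfolding edges by (rule subset_imp_msubset_mset_set) (use \<pi>(2) in auto)
  also have "\<dots> \<subseteq># E" by (rule mset_set_set_mset_msubset)
  finally obtain E' where E': "E = tableau_edges k T0 + E'" by (auto simp: subset_mset.le_iff_add)
  have "deg E' v = d" if v: "v \<in> {1..2*k}" for v
    using Suc.prems(2)[OF v] tableau_deg[OF T0 v] unfolding E' by simp
  moreover have "set_mset E' \<subseteq> {1..k} \<times> {k+1..2*k}" using Suc.prems(1) unfolding E' by simp
  ultimately obtain T where T: "\<forall>j<d. is_tableau k (T j)"
    "\<forall>p. bracket_monomial E' p = (\<Prod>j<d. bracket_monomial (tableau_edges k (T j)) p)"
    using Suc.IH by blast
  show ?case
    by (rule exI[of _ "T(d := T0)"]) (use T T0 in \<open>auto simp: E' less_Suc_eq\<close>)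
qed

definition tableau_products :: "nat \<Rightarrow> nat \<Rightarrow> ((nat \<Rightarrow> complex^2) \<Rightarrow> complex) set" where
  "tableau_products k d = cfun.span {\<lambda>p. \<Prod>j<d. bracket_monomial (tableau_edges k (T j)) p | T.
     \<forall>j<d. is_tableau k (T j)}"

text \<open>Edges between the two halves contribute equally to the sums of the degrees of the lower and of
  the upper vertices. So for a regular graph there are as many edges inside one half as inside
  the other.\<close>

lemma low_edges_eq_high_edges:
  assumes "set_mset E \<subseteq> {1..2*k} \<times> {1..2*k}"
  shows "(\<Sum>v=1..k. deg E v) + 2 * size (filter_mset (\<lambda>e. fst e > k \<and> snd e > k) E) =
    (\<Sum>v=k+1..2*k. deg E v) + 2 * size (filter_mset (\<lambda>e. fst e \<le> k \<and> snd e \<le> k) E)"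
  using assms
proof (induction E)
  case (add e E)
  have s: "(\<Sum>v\<in>S. of_bool (x = v)) = (if x \<in> S then 1 else 0 :: nat)" if "finite S" for x S
    using that by (simp add: of_bool_def)
  show ?case using add by (auto simp: sum.distrib s)
qed simp

lemma flip_edges:
  "\<exists>c. \<forall>p. bracket_monomial E p =
     c * bracket_monomial (image_mset (\<lambda>e. if fst e \<le> k then e else (snd e, fst e)) E) p"
proof (induction E)
  case empty
  show ?case by (intro exI[of _ 1]) simp
next
  case (add e E)
  then obtain c where c: "\<forall>p. bracket_monomial E p =
     c * bracket_monomial (image_mset (\<lambda>e. if fst e \<le> k then e else (snd e, fst e)) E) p" by blast
  show ?case
  proof (cases "fst e \<le> k")
    case True
    then show ?thesis using c by (intro exI[of _ c]) simp
  next
    case False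
    then show ?thesis using c bracket_swap by (intro exI[of _ "- c"]) (simp add: bracket_def algebra_simps)
  qed
qed

lemma deg_flip: "deg (image_mset (\<lambda>e. if fst e \<le> k then e else (snd e, fst e)) E) v = deg E v"
  by (induction E) auto

text \<open>Kempe's theorem, by induction on the number of edges inside the lower half. If there is such
  an edge \<open>(a, b)\<close>, there also is an edge \<open>(c, e)\<close> inside the upper half, and both graphs on
  the other side of the Pluecker relation for \<open>a, b, c, e\<close> have fewer edges inside the lower
  half.\<close>

theorem regular_bracket_monomial_in_tableau_products:
  assumes "set_mset E \<subseteq> {1..2*k} \<times> {1..2*k}" "\<And>v. v \<in> {1..2*k} \<Longrightarrow> deg E v = d"
  shows "bracket_monomial E \<in> tableau_products k d"
  using assms
proof (induction "size (filter_mset (\<lambda>e. fst e \<le> k \<and> snd e \<le> k) E)" arbitrary: E rule: less_induct)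
  case less
  let ?low = "\<lambda>e :: nat \<times> nat. fst e \<le> k \<and> snd e \<le> k"
  let ?high = "\<lambda>e :: nat \<times> nat. fst e > k \<and> snd e > k"
  have "(\<Sum>v=1..k. deg E v) = (\<Sum>v=k+1..2*k. deg E v)"
    using less.prems(2) by simp
  then have lh: "size (filter_mset ?low E) = size (filter_mset ?high E)"
    using low_edges_eq_high_edges[OF less.prems(1)] by simp
  show ?case
  proof (cases "filter_mset ?low E = {#}")
    case True
    have "size (filter_mset ?high E) = 0" using lh[unfolded True] by (simp only: size_empty)
    then have high: "filter_mset ?high E = {#}" by (simp only: size_eq_0_iff_empty)
    have cross: "\<not> ?low e" "\<not> ?high e" if "e \<in># E" for e
      using True[unfolded filter_mset_eq_mempty_iff] high[unfolded filter_mset_eq_mempty_iff] that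
      by blast+
    \<comment> \<open>Orient all edges upwards; this changes the product of brackets only by a sign.\<close>
    let ?E = "image_mset (\<lambda>e. if fst e \<le> k then e else (snd e, fst e)) E"
    have "set_mset ?E \<subseteq> {1..k} \<times> {k+1..2*k}"
    proof
      fix x assume "x \<in> set_mset ?E"
      then obtain e where e: "x = (if fst e \<le> k then e else (snd e, fst e))" "e \<in># E"
        unfolding set_image_mset by (rule imageE)
      moreover have "fst e \<in> {1..2*k}" "snd e \<in> {1..2*k}" using less.prems(1) e(2) by auto
      ultimately show "x \<in> {1..k} \<times> {k+1..2*k}" using cross[OF e(2)] by (cases e) auto
    qed
    then obtain T where T: "\<forall>j<d. is_tableau k (T j)"
      "\<forall>p. bracket_monomial ?E p = (\<Prod>j<d. bracket_monomial (tableau_edges k (T j)) p)"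
      using regular_bipartite_tableaux[of ?E k d] less.prems(2) unfolding deg_flip by blast
    obtain c where "\<forall>p. bracket_monomial E p = c * bracket_monomial ?E p" using flip_edges by blast
    then have "bracket_monomial E = fscale c (\<lambda>p. \<Prod>j<d. bracket_monomial (tableau_edges k (T j)) p)"
      using T(2) by (simp add: fscale_def fun_eq_iff)
    moreover have "\<dots> \<in> tableau_products k d"
      unfolding tableau_products_def
      by (intro cfun.span_scale cfun.span_base CollectI exI[of _ T] conjI T(1)) simp
    ultimately show ?thesis by simp
  next
    case False
    then obtain x where x: "x \<in># filter_mset ?low E" by blast
    have "filter_mset ?high E \<noteq> {#}" using False lh by (metis size_eq_0_iff_empty)
    then obtain y where y: "y \<in># filter_mset ?high E" by blast
    obtain a b where ab: "x = (a, b)" by (cases x)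
    obtain c e where ce: "y = (c, e)" by (cases y)
    have le: "a \<le> k" "b \<le> k" "c > k" "e > k" "x \<in># E" "y \<in># E" using x y ab ce by auto
    then have "y \<in># E - {#x#}" using ab ce by (auto simp: in_diff_count not_in_iff)
    then obtain E0 where E0: "E = add_mset (a, b) (add_mset (c, e) E0)"
      using le(5) ab ce by (metis insert_DiffM)
    let ?E1 = "add_mset (a, c) (add_mset (b, e) E0)"
    let ?E2 = "add_mset (a, e) (add_mset (c, b) E0)"
    have "bracket_monomial E = bracket_monomial ?E1 + bracket_monomial ?E2"
    proof
      fix p show "bracket_monomial E p = (bracket_monomial ?E1 + bracket_monomial ?E2) p"
        using arg_cong[OF bracket_plucker[of "p a" "p b" "p c" "p e"], of "\<lambda>z. z * bracket_monomial E0 p"]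
        by (simp add: E0 algebra_simps)
    qed
    moreover have "bracket_monomial ?E1 \<in> tableau_products k d"
    proof (rule less.hyps)
      show "size (filter_mset ?low ?E1) < size (filter_mset ?low E)" using le by (simp add: E0)
      show "set_mset ?E1 \<subseteq> {1..2*k} \<times> {1..2*k}" using less.prems(1) by (auto simp: E0)
      show "deg ?E1 v = d" if "v \<in> {1..2*k}" for v
        using less.prems(2)[OF that] by (simp add: E0)
    qed
    moreover have "bracket_monomial ?E2 \<in> tableau_products k d"
    proof (rule less.hyps)
      show "size (filter_mset ?low ?E2) < size (filter_mset ?low E)" using le by (simp add: E0)
      show "set_mset ?E2 \<subseteq> {1..2*k} \<times> {1..2*k}" using less.prems(1) by (auto simp: E0)
      show "deg ?E2 v = d" if "v \<in> {1..2*k}" for v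
        using less.prems(2)[OF that] by (simp add: E0)
    qed
    ultimately show ?thesis unfolding tableau_products_def by (simp only: cfun.span_add)
  qed
qed

section \<open>The invariant ring and the main theorem\<close>

lemma invertible_matrix_inv:
  fixes A :: "complex^2^2"
  assumes "invertible A"
  shows "A ** matrix_inv A = mat 1" "matrix_inv A ** A = mat 1"
proof -
  have "\<exists>B. A ** B = mat 1 \<and> B ** A = mat 1" using assms by (simp add: invertible_def)
  from someI_ex[OF this] show "A ** matrix_inv A = mat 1" "matrix_inv A ** A = mat 1"
    unfolding matrix_inv_def by blast+
qed

text \<open>Products of brackets of degree \<open>d\<close> in each of \<open>2 k\<close> vectors are multiplied by the \<open>k d\<close>-th power
  of the determinant, which is the power in the linearization. The converse is the first
  fundamental theorem.\<close>

lemma bracket_span_eq_invariant_sections: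
  "invariant_sections k d = bracket_span (2 * k) (\<lambda>_. d)"
proof (intro equalityI subsetI)
  fix s assume s: "s \<in> invariant_sections k d"
  have inv: "s (\<lambda>i. A *v p i) = det A ^ (k * d) * s p" if A: "invertible A" for A p
  proof -
    let ?B = "matrix_inv A"
    \<comment> \<open>The action is by the inverse matrix, so the invariance is used at \<open>A p\<close>.\<close>
    have BA: "?B ** A = mat 1" using A by (rule invertible_matrix_inv(2))
    have "pgl_action k d A s = s" using s A by (auto simp: invariant_sections_def)
    then have "s (\<lambda>i. A *v p i) = det A ^ (k * d) * s (\<lambda>i. ?B *v (A *v p i))"
      unfolding pgl_action_def by metis
    also have "(\<lambda>i. ?B *v (A *v p i)) = p"
      by (simp add: matrix_vector_mul_assoc BA)
    finally show ?thesis .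
  qed
  show "s \<in> bracket_span (2 * k) (\<lambda>_. d)"
  proof (rule semi_invariant_in_bracket_span)
    show "s \<in> multihom (2 * k) (\<lambda>_. d)"
      using s by (simp add: invariant_sections_def sections_O_multihom)
    show "(\<Sum>i=1..2*k. d) = 2 * (k * d)" by simp
  qed (rule inv)
next
  fix s assume s: "s \<in> bracket_span (2 * k) (\<lambda>_. d)"
  have "pgl_action k d A s = s" if A: "invertible A" for A
  proof
    fix p
    have "A ** matrix_inv A = mat 1" using A by (rule invertible_matrix_inv(1))
    then have "det A * det (matrix_inv A) = 1" by (metis det_I det_mul)
    moreover have "s (\<lambda>i. matrix_inv A *v p i) = det (matrix_inv A) ^ (k * d) * s p"
      by (rule bracket_span_semi_invariant[OF s]) simp
    ultimately show "pgl_action k d A s p = s p"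
      by (simp add: pgl_action_def flip: mult.assoc power_mult_distrib)
  qed
  then show "s \<in> invariant_sections k d"
    using s bracket_span_multihom by (auto simp: invariant_sections_def sections_O_multihom)
qed

lemma bracket_span_mult:
  assumes "f \<in> bracket_span n D" "g \<in> bracket_span n D'"
  shows "f * g \<in> bracket_span n (\<lambda>i. D i + D' i)"
  using assms unfolding bracket_span_def
proof (rule span_mult_closed)
  fix a b
  assume "a \<in> {bracket_monomial E | E. set_mset E \<subseteq> {1..n} \<times> {1..n} \<and> (\<forall>v\<in>{1..n}. deg E v = D v)}"
    and "b \<in> {bracket_monomial E | E. set_mset E \<subseteq> {1..n} \<times> {1..n} \<and> (\<forall>v\<in>{1..n}. deg E v = D' v)}"
  then obtain E E' where E: "a = bracket_monomial E" "set_mset E \<subseteq> {1..n} \<times> {1..n}" "\<forall>v\<in>{1..n}. deg E v = D v"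
    and E': "b = bracket_monomial E'" "set_mset E' \<subseteq> {1..n} \<times> {1..n}" "\<forall>v\<in>{1..n}. deg E' v = D' v" by blast
  have "a * b = bracket_monomial (E + E')"
    unfolding E(1) E'(1) by (intro ext) simp
  moreover have "\<dots> \<in> bracket_span n (\<lambda>i. D i + D' i)"
    by (rule bracket_monomial_in_span) (use E E' in auto)
  ultimately show "a * b \<in> cfun.span {bracket_monomial E | E.
      set_mset E \<subseteq> {1..n} \<times> {1..n} \<and> (\<forall>v\<in>{1..n}. deg E v = D v + D' v)}"
    unfolding bracket_span_def by simp
qed

text \<open>The chart of affine representatives, where \<open>\<alpha> i\<close> is the coordinate of the \<open>i\<close>-th point of
  the projective line.\<close>

definition affine_points :: "(nat \<Rightarrow> complex) \<Rightarrow> nat \<Rightarrow> complex^2" where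
  "affine_points \<alpha> = (\<lambda>i. vector [\<alpha> i, 1])"

text \<open>If all second coordinates are nonzero, each vector can be rescaled to an affine
  representative; the general case follows by continuity.\<close>

lemma multihom_zero_on_affine:
  assumes f: "f \<in> multihom n D" and zero: "\<And>\<alpha>. f (affine_points \<alpha>) = 0"
  shows "f = 0"
proof
  fix p :: "nat \<Rightarrow> complex^2"
  have nz: "f q = 0" if q: "\<And>i. i \<in> {1..n} \<Longrightarrow> q i $ 2 \<noteq> 0" for q
  proof -
    have "f q = (\<Prod>i=1..n. (q i $ 2) ^ D i) * f (affine_points (\<lambda>i. q i $ 1 / q i $ 2))"
      using f unfolding multihom_def
    proof (induction rule: cfun.span_induct_alt)
      case (step c m g)
      then obtain e where e: "m = monomial n D e" "\<forall>i\<in>{1..n}. e i \<le> D i" by blast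
      have "m q = (\<Prod>i=1..n. (q i $ 2) ^ D i) * m (affine_points (\<lambda>i. q i $ 1 / q i $ 2))"
        unfolding e(1) monomial_def prod.distrib[symmetric]
      proof (rule prod.cong[OF refl])
        fix i assume i: "i \<in> {1..n}"
        then have "(q i $ 2) ^ D i = (q i $ 2) ^ e i * (q i $ 2) ^ (D i - e i)"
          using e(2) by (simp flip: power_add)
        then show "q i $ 1 ^ e i * q i $ 2 ^ (D i - e i) = q i $ 2 ^ D i *
            (affine_points (\<lambda>i. q i $ 1 / q i $ 2) i $ 1 ^ e i *
             affine_points (\<lambda>i. q i $ 1 / q i $ 2) i $ 2 ^ (D i - e i))"
          using q[OF i] by (simp add: affine_points_def power_divide)
      qed
      with step.IH show ?case by (simp add: fscale_def algebra_simps)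
    qed simp
    then show ?thesis using zero by simp
  qed
  define \<gamma> where "\<gamma> t i = p i + (vector [0, t] :: complex^2)" for t :: complex and i
  have \<gamma>2: "\<gamma> t i $ 2 = p i $ 2 + t" for t i by (simp add: \<gamma>_def)
  have "((\<lambda>t. \<gamma> t i) \<longlongrightarrow> p i) (at 0)" for i
  proof (rule vec_tendstoI)
    fix j :: 2 show "((\<lambda>t. \<gamma> t i $ j) \<longlongrightarrow> p i $ j) (at 0)"
      unfolding \<gamma>_def using exhaust_2[of j] by (elim disjE; simp; auto intro!: tendsto_eq_intros)
  qed
  then have lim1: "((\<lambda>t. f (\<gamma> t)) \<longlongrightarrow> f p) (at 0)" by (rule multihom_tendsto[OF f])
  have "eventually (\<lambda>t. \<forall>i\<in>{1..n}. t \<noteq> - (p i $ 2)) (at 0)"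
    by (intro eventually_ball_finite ballI eventually_neq_at_within) simp
  then have "eventually (\<lambda>t. f (\<gamma> t) = 0) (at 0)"
    by (rule eventually_mono) (auto intro!: nz simp: \<gamma>2 add_eq_0_iff)
  then have lim2: "((\<lambda>t. f (\<gamma> t)) \<longlongrightarrow> 0) (at 0)" by (rule tendsto_eventually)
  show "f p = 0 p" using tendsto_unique[OF at_neq_bot lim1 lim2] by simp
qed

lemma tableau_poly_affine:
  "bracket_monomial (tableau_edges k T) (affine_points \<alpha>) = tableau_poly k T \<alpha>"
  by (simp add: bracket_monomial_def tableau_edges_def tableau_poly_def affine_points_def bracket_def
      multiset.map_comp comp_def prod_unfold_prod_mset)

text \<open>A tableau gives an invariant of degree one that restricts to its tableau polynomial. By the
  fundamental theorem and Kempe's theorem, invariants of degree \<open>d\<close> are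
  combinations of products of \<open>d\<close> such invariants.\<close>

lemma invariants_generated_in_degree_one:
  "generated_in_degree_one (specht k) (invariant_sections k) affine_points"
proof
  show "cfun.subspace (specht k)" by (simp add: specht_def)
  show "cfun.subspace (invariant_sections k d)" for d
    unfolding bracket_span_eq_invariant_sections by (simp add: bracket_span_def)
  have "bracket_monomial {#} \<in> bracket_span (2 * k) (\<lambda>_. 0)"
    by (rule bracket_monomial_in_span) auto
  moreover have "bracket_monomial {#} = 1" by (rule ext) simp
  ultimately show "1 \<in> invariant_sections k 0"
    unfolding bracket_span_eq_invariant_sections by simp
  show "f * g \<in> invariant_sections k (d + e)"
    if "f \<in> invariant_sections k d" "g \<in> invariant_sections k e" for d e f g
    using that unfolding bracket_span_eq_invariant_sections by (rule bracket_span_mult)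
  show "s = 0" if "s \<in> invariant_sections k d" "\<And>x. s (affine_points x) = 0" for d s
    using that bracket_span_multihom unfolding bracket_span_eq_invariant_sections
    by (intro multihom_zero_on_affine) auto
next
  fix f assume "f \<in> specht k"
  then show "\<exists>s\<in>invariant_sections k 1. \<forall>x. s (affine_points x) = f x"
    unfolding specht_def bracket_span_eq_invariant_sections
  proof (induction rule: cfun.span_induct_alt)
    case base
    have "0 \<in> bracket_span (2 * k) (\<lambda>_. 1)" by (simp only: bracket_span_def cfun.span_zero)
    then show ?case by (intro bexI[of _ 0]) auto
  next
    case (step c m f)
    then obtain T where T: "m = tableau_poly k T" "is_tableau k T" by blast
    obtain s where s: "s \<in> bracket_span (2 * k) (\<lambda>_. 1)" "\<forall>x. s (affine_points x) = f x"
      using step by blast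
    let ?B = "bracket_monomial (tableau_edges k T)"
    have "?B \<in> bracket_span (2 * k) (\<lambda>_. 1)"
      using tableau_edges_range[OF T(2)] tableau_deg[OF T(2)] by (rule bracket_monomial_in_span)
    then have "fscale c ?B + s \<in> bracket_span (2 * k) (\<lambda>_. 1)"
      using s(1) unfolding bracket_span_def by (intro cfun.span_add cfun.span_scale)
    moreover have "\<forall>x. (fscale c ?B + s) (affine_points x) = (fscale c m + f) x"
      using s(2) by (simp add: fscale_def T(1) tableau_poly_affine)
    ultimately show ?case by blast
  qed
next
  fix d s assume "s \<in> invariant_sections k d"
  then have "s \<in> bracket_span (2 * k) (\<lambda>_. d)"
    by (simp only: bracket_span_eq_invariant_sections)
  moreover have "bracket_span (2 * k) (\<lambda>_. d) \<subseteq> tableau_products k d"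
    unfolding bracket_span_def
    by (rule cfun.span_minimal)
      (use regular_bracket_monomial_in_tableau_products in \<open>auto simp: tableau_products_def\<close>)
  ultimately have "s \<in> tableau_products k d" by blast
  then show "\<exists>F\<in>hom_polys (specht k) d. \<forall>x. s (affine_points x) = F (eval_at (specht k) x)"
    unfolding tableau_products_def
  proof (induction rule: cfun.span_induct_alt)
    case base
    have "0 \<in> hom_polys (specht k) d" by (simp only: hom_polys_def cfun.span_zero)
    then show ?case by (intro bexI[of _ 0]) auto
  next
    case (step c m s)
    then obtain T where T: "m = (\<lambda>p. \<Prod>j<d. bracket_monomial (tableau_edges k (T j)) p)"
      "\<forall>j<d. is_tableau k (T j)" by blast
    obtain F where F: "F \<in> hom_polys (specht k) d"
      "\<forall>x. s (affine_points x) = F (eval_at (specht k) x)" using step by blast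
    let ?G = "\<lambda>l. \<Prod>j<d. l (tableau_poly k (T j))"
    have mem: "tableau_poly k (T j) \<in> specht k" if "j < d" for j
      unfolding specht_def using T(2) that by (intro cfun.span_base) blast
    then have "?G \<in> hom_polys (specht k) d" by (rule hom_polys_generator)
    then have "fscale c ?G + F \<in> hom_polys (specht k) d"
      using F(1) unfolding hom_polys_def by (intro cfun.span_add cfun.span_scale)
    moreover have "(fscale c m + s) (affine_points x) = (fscale c ?G + F) (eval_at (specht k) x)" for x
    proof -
      have "m (affine_points x) = ?G (eval_at (specht k) x)"
        unfolding T(1) tableau_poly_affine by (rule prod.cong) (use mem in \<open>auto simp: eval_at_def\<close>)
      then show ?thesis using F(2) by (simp add: fscale_def)
    qed
    ultimately show ?case by blast
  qed
qed

theorem proposition5p7: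
  fixes k :: nat
  assumes "k \<ge> 2"
  shows "hyperelliptic_goepel_variety k \<cong>\<^sub>v democratic_GIT_quotient k"
  using generated_in_degree_one.closure_of_image_iso_Proj[OF invariants_generated_in_degree_one]
  unfolding isomorphic_varieties_def hyperelliptic_goepel_variety_def goepel_points_def
    democratic_GIT_quotient_def by blast

end
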